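(* Let $k\ge 5$ and $n$ be integers. Assume that exactly one representative of each isomorphism class of connected cubic graphs with $n-4$ vertices, girth at least $k-1$ and at most $3$ disjoint cycles of size $k-1$ is given. Apply the following steps to the given graphs: (1) for each given graph $H$, apply the tripod insertion operation to one edge-triple in each orbit (under $\operatorname{Aut}(H)$) of eligible edge-triples of $H$; (2) accept each resulting graph with $n$ vertices if and only if the inserted tripod has minimal value of $(x_0,\dots,x_4)$ (in lexicographic order) among all reducible tripods of the resulting graph. Then exactly one representative of each isomorphism class of connected cubic graphs with $n$ vertices and girth at least $k$ is accepted.
   Context: Graphs are finite and simple. A cubic graph is a $3$-regular graph; the girth is the length of a shortest cycle. Two subgraphs are disjoint if they have no common vertices (a set of cycles is disjoint if its members are pairwise disjoint). An edge-triple of a graph is a set of $3$ different edges (they may share vertices). The tripod (insertion/expansion) operation applied to an edge-triple $\{e_1,e_2,e_3\}$ of a cubic graph subdivides each $e_i$ with a new vertex $v_i$ and adds one new vertex $c$ adjacent to $v_1,v_2,v_3$; this yields a cubic graph with $4$ more vertices. The inserted $K_{1,3}$ (with vertices $c,v_1,v_2,v_3$) is called the inserted tripod and $c$ is its central vertex. In general, a tripod in a cubic graph is a $K_{1,3}$ consisting of a vertex $c$ (the central vertex, which uniquely identifies the tripod) and its three neighbours (the endvertices). The tripod reduction is the inverse operation: delete $c$ and replace each of its former neighbours, which then has degree $2$, together with its two incident edges by a single edge. A tripod is reducible if its central vertex is not a cut vertex and each cycle containing $i$ endvertices of the tripod has length at least $3+i$. The edge-distance $d_e(e,e')$ between two edges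 is the number of edges in a shortest path containing $e$ and $e'$. The minimum edge-triple distance is $d_t(e_1,e_2,e_3)=\min\{d_e(e_1,e_2),d_e(e_1,e_3),d_e(e_2,e_3)\}$. For a cubic graph with girth at least $k-1$ and at most $3$ disjoint cycles of size $k-1$, an edge-triple $\{e_1,e_2,e_3\}$ is eligible if $d_t(e_1,e_2,e_3)\ge k-2$ and applying the tripod operation to it destroys all cycles of size $k-1$ (i.e. every cycle of size $k-1$ contains at least one of $e_1,e_2,e_3$). Two edge-triples are in the same orbit if some automorphism of the graph maps one to the other as sets. To the central vertex $c$ of every reducible tripod of a graph $G$ one assigns the $5$-tuple $(x_0,\dots,x_4)$, where: $x_0$ is the number of neighbours of $c$ which are part of a pentagon ($5$-cycle) not containing $c$; $x_1$ is the number of neighbours of $c$ which are part of a hexagon ($6$-cycle) not containing $c$; $x_2$ is the number of vertices at distance at most $3$ from $c$; $x_3$ is the number of vertices at distance at most $4$ from $c$; and $x_4$ is the smallest label, in a canonical labelling of $G$, of a vertex in the same orbit of $\operatorname{Aut}(G)$ as $c$. Here a canonical labelling is fixed once and for all: a function assigning to every graph $G$ a bijection from $V(G)$ to $\{0,\dots,|V(G)|-1\}$ such that the relabelled graphs of any two isomorphic graphs are identical. Tuples are compared lexicographically. *)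

theory Defs
  imports
    "HOL-Library.Extended_Nat"
    "HOL-Library.Product_Lexorder"
    "HOL-Library.Infinite_Typeclass"
begin

section \<open>Graphs, paths and cycles\<close>

record 'v graph =
  verts :: "'v set"
  edges :: "'v set set"

definition simple_graph :: "'v graph \<Rightarrow> bool" where
  "simple_graph G \<longleftrightarrow> finite (verts G) \<and> (\<forall>e\<in>edges G. e \<subseteq> verts G \<and> card e = 2)"

definition nbrs :: "'v graph \<Rightarrow> 'v \<Rightarrow> 'v set" where
  "nbrs G v = {w. {v, w} \<in> edges G}"

definition cubic :: "'v graph \<Rightarrow> bool" where
  "cubic G \<longleftrightarrow> simple_graph G \<and> (\<forall>v\<in>verts G. card (nbrs G v) = 3)"

definition walk_edges :: "'v list \<Rightarrow> 'v set set" where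
  "walk_edges p = {{p ! i, p ! Suc i} | i. Suc i < length p}"

definition is_path :: "'v graph \<Rightarrow> 'v list \<Rightarrow> bool" where
  "is_path G p \<longleftrightarrow> p \<noteq> [] \<and> distinct p \<and> set p \<subseteq> verts G \<and> walk_edges p \<subseteq> edges G"

text \<open>
  A cycle is given by the cyclic sequence of its vertices, without repetition of the first one,
  so that \<open>length c\<close> is the size of the cycle and \<open>set c\<close> its vertex set.  The same
  cycle subgraph is represented by several lists, all of them with the same vertex set and
  the same edge set.
\<close>

definition cycle_edges :: "'v list \<Rightarrow> 'v set set" where
  "cycle_edges c = walk_edges (c @ [hd c])"

definition is_cycle :: "'v graph \<Rightarrow> 'v list \<Rightarrow> bool" where
  "is_cycle G c \<longleftrightarrow>
     3 \<le> length c \<and> distinct c \<and> set c \<subseteq> verts G \<and> cycle_edges c \<subseteq> edges G"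

text \<open>The infimum of the empty set in \<^typ>\<open>enat\<close> is \<open>\<infinity>\<close>, the girth of an acyclic graph.\<close>

definition girth :: "'v graph \<Rightarrow> enat" where
  "girth G = (INF c \<in> {c. is_cycle G c}. enat (length c))"

definition joined :: "'v graph \<Rightarrow> 'v \<Rightarrow> 'v \<Rightarrow> bool" where
  "joined G u v \<longleftrightarrow> (\<exists>p. is_path G p \<and> hd p = u \<and> last p = v)"

definition connected_graph :: "'v graph \<Rightarrow> bool" where
  "connected_graph G \<longleftrightarrow> verts G \<noteq> {} \<and> (\<forall>u\<in>verts G. \<forall>v\<in>verts G. joined G u v)"

definition delete_vertex :: "'v graph \<Rightarrow> 'v \<Rightarrow> 'v graph" where
  "delete_vertex G v = \<lparr>verts = verts G - {v}, edges = {e \<in> edges G. v \<notin> e}\<rparr>"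

definition cut_vertex :: "'v graph \<Rightarrow> 'v \<Rightarrow> bool" where
  "cut_vertex G v \<longleftrightarrow> v \<in> verts G \<and>
     (\<exists>u \<in> verts G - {v}. \<exists>w \<in> verts G - {v}.
        joined G u w \<and> \<not> joined (delete_vertex G v) u w)"

definition gdist :: "'v graph \<Rightarrow> 'v \<Rightarrow> 'v \<Rightarrow> enat" where
  "gdist G u v = (INF p \<in> {p. is_path G p \<and> hd p = u \<and> last p = v}. enat (length p - 1))"

text \<open>Any family of pairwise vertex-disjoint cycles of size \<open>l\<close> has at most \<open>m\<close> members;
  two lists for the same cycle are not disjoint.\<close>

definition at_most_disjoint_cycles :: "'v graph \<Rightarrow> nat \<Rightarrow> nat \<Rightarrow> bool" where
  "at_most_disjoint_cycles G m l \<longleftrightarrow>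
     (\<forall>C. (\<forall>c\<in>C. is_cycle G c \<and> length c = l) \<and> pairwise (\<lambda>c d. set c \<inter> set d = {}) C
        \<longrightarrow> finite C \<and> card C \<le> m)"

section \<open>Isomorphisms and canonical labellings\<close>

definition relabel :: "('v \<Rightarrow> 'w) \<Rightarrow> 'v graph \<Rightarrow> 'w graph" where
  "relabel f G = \<lparr>verts = f ` verts G, edges = (\<lambda>e. f ` e) ` edges G\<rparr>"

definition graph_iso :: "('v \<Rightarrow> 'w) \<Rightarrow> 'v graph \<Rightarrow> 'w graph \<Rightarrow> bool" where
  "graph_iso f G H \<longleftrightarrow> inj_on f (verts G) \<and> relabel f G = H"

definition isomorphic :: "'v graph \<Rightarrow> 'w graph \<Rightarrow> bool" where
  "isomorphic G H \<longleftrightarrow> (\<exists>f. graph_iso f G H)"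

definition canonical_labelling :: "('v graph \<Rightarrow> 'v \<Rightarrow> nat) \<Rightarrow> bool" where
  "canonical_labelling canon \<longleftrightarrow>
     (\<forall>G. simple_graph G \<longrightarrow> bij_betw (canon G) (verts G) {0..<card (verts G)}) \<and>
     (\<forall>G H. simple_graph G \<and> simple_graph H \<and> isomorphic G H
        \<longrightarrow> relabel (canon G) G = relabel (canon H) H)"

definition vertex_orbit :: "'v graph \<Rightarrow> 'v \<Rightarrow> 'v set" where
  "vertex_orbit G v = {f v | f. graph_iso f G G}"

text \<open>
  The indexed family \<open>g\<close> over \<open>I\<close> consists of exactly one representative of each isomorphism
  class of graphs in \<open>\<C>\<close>.  Members with different indices count as different, even if they
  happen to be the same graph.
\<close>

definition exactly_one_representative ::
    "('i \<Rightarrow> 'v graph) \<Rightarrow> 'i set \<Rightarrow> 'v graph set \<Rightarrow> bool" where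
  "exactly_one_representative g I \<C> \<longleftrightarrow>
     (\<forall>i\<in>I. g i \<in> \<C>) \<and> (\<forall>G\<in>\<C>. \<exists>!i. i \<in> I \<and> isomorphic G (g i))"

section \<open>Edge-triples and the tripod operation\<close>

definition edge_triple :: "'v graph \<Rightarrow> 'v set set \<Rightarrow> bool" where
  "edge_triple G T \<longleftrightarrow> T \<subseteq> edges G \<and> card T = 3"

definition same_triple_orbit :: "'v graph \<Rightarrow> 'v set set \<Rightarrow> 'v set set \<Rightarrow> bool" where
  "same_triple_orbit G T T' \<longleftrightarrow> (\<exists>f. graph_iso f G G \<and> (\<lambda>e. f ` e) ` T = T')"

definition edge_dist :: "'v graph \<Rightarrow> 'v set \<Rightarrow> 'v set \<Rightarrow> enat" where
  "edge_dist G e e' =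
     (INF p \<in> {p. is_path G p \<and> e \<in> walk_edges p \<and> e' \<in> walk_edges p}. enat (length p - 1))"

definition min_triple_dist :: "'v graph \<Rightarrow> 'v set set \<Rightarrow> enat" where
  "min_triple_dist G T = Min {edge_dist G e e' | e e'. e \<in> T \<and> e' \<in> T \<and> e \<noteq> e'}"

definition eligible :: "nat \<Rightarrow> 'v graph \<Rightarrow> 'v set set \<Rightarrow> bool" where
  "eligible k G T \<longleftrightarrow> edge_triple G T \<and> enat (k - 2) \<le> min_triple_dist G T \<and>
     (\<forall>c. is_cycle G c \<and> length c = k - 1 \<longrightarrow> cycle_edges c \<inter> T \<noteq> {})"

text \<open>
  \<open>G\<close> results from \<open>H\<close> by the tripod operation applied to the edge-triple \<open>T\<close>, where
  \<open>s e\<close> is the new vertex subdividing \<open>e \<in> T\<close> and \<open>c\<close> is the central vertex of the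
  inserted tripod.  The choice of the new vertices is left open.
\<close>

definition tripod_insertion ::
    "'v graph \<Rightarrow> 'v set set \<Rightarrow> 'v graph \<Rightarrow> 'v \<Rightarrow> bool" where
  "tripod_insertion H T G c \<longleftrightarrow> edge_triple H T \<and>
     (\<exists>s. inj_on s T \<and> s ` T \<inter> verts H = {} \<and> c \<notin> verts H \<union> s ` T \<and>
        G = \<lparr>verts = verts H \<union> s ` T \<union> {c},
             edges = (edges H - T) \<union> {{u, s e} | u e. e \<in> T \<and> u \<in> e} \<union> {{c, s e} | e. e \<in> T}\<rparr>)"

text \<open>A tripod of a cubic graph is identified with its central vertex; its endvertices are
  the neighbours of that vertex.\<close>

definition reducible_tripod :: "'v graph \<Rightarrow> 'v \<Rightarrow> bool" where
  "reducible_tripod G c \<longleftrightarrow> c \<in> verts G \<and> \<not> cut_vertex G c \<and>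
     (\<forall>z. is_cycle G z \<longrightarrow> 3 + card (set z \<inter> nbrs G c) \<le> length z)"

definition nbrs_in_cycle_avoiding :: "'v graph \<Rightarrow> nat \<Rightarrow> 'v \<Rightarrow> nat" where
  "nbrs_in_cycle_avoiding G l c =
     card {w \<in> nbrs G c. \<exists>z. is_cycle G z \<and> length z = l \<and> w \<in> set z \<and> c \<notin> set z}"

definition within_dist :: "'v graph \<Rightarrow> nat \<Rightarrow> 'v \<Rightarrow> nat" where
  "within_dist G d c = card {v \<in> verts G. gdist G c v \<le> enat d}"

definition min_orbit_label :: "('v graph \<Rightarrow> 'v \<Rightarrow> nat) \<Rightarrow> 'v graph \<Rightarrow> 'v \<Rightarrow> nat" where
  "min_orbit_label canon G c = Min (canon G ` vertex_orbit G c)"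

text \<open>Tuples are compared by the lexicographic order of \<^theory>\<open>HOL-Library.Product_Lexorder\<close>.\<close>

definition tripod_value ::
    "('v graph \<Rightarrow> 'v \<Rightarrow> nat) \<Rightarrow> 'v graph \<Rightarrow> 'v \<Rightarrow> nat \<times> nat \<times> nat \<times> nat \<times> nat" where
  "tripod_value canon G c =
     (nbrs_in_cycle_avoiding G 5 c, nbrs_in_cycle_avoiding G 6 c,
      within_dist G 3 c, within_dist G 4 c, min_orbit_label canon G c)"

definition accepted :: "('v graph \<Rightarrow> 'v \<Rightarrow> nat) \<Rightarrow> 'v graph \<Rightarrow> 'v \<Rightarrow> bool" where
  "accepted canon G c \<longleftrightarrow> is_arg_min (tripod_value canon G) (reducible_tripod G) c"

end

theory Submission
  imports Defs
begin

text \<open>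
  Canonical construction path.  A connected cubic graph \<open>G\<close> of girth at least \<open>k\<close> has a vertex that is not
  a cut vertex, and since the girth is at least 5 this vertex is the centre of a reducible tripod;
  choose \<open>c\<close> with the minimal tuple.  Reducing this tripod gives a graph \<open>H\<close> with an edge-triple
  whose insertion is \<open>G\<close>.  Lengths of walks in \<open>H\<close> and \<open>G\<close> differ by the number of traversed edges of
  the triple.  A cycle of \<open>H\<close> with two of them splits into arcs of \<open>G\<close> that are long because \<open>c\<close>
  closes them to cycles; conversely a cycle through \<open>c\<close> is long because of the distance condition
  on the triple.  For uniqueness, the last entry of the tuple determines the orbit of \<open>c\<close>, so an isomorphism
  between two accepted graphs can be chosen to map centre to centre, and it then restricts to an
  isomorphism of the reductions that maps one edge-triple to the other.
\<close>

section \<open>Walks, paths and cycles\<close>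

text \<open>All length arguments rest on one inequality: a walk of length m in H from an end of one
  triple edge to an end of another satisfies k \<le> m + 4. The constant fits both graphs. In G such
  a walk is closed through c by four more edges, two at c and one half of each subdivided edge. In H
  the two triple edges prolong it to m + 2 edges, and eligibility demands k - 2. Edge distance is
  defined by paths, but contracting or cutting a path need not leave a path with the right ends.
  Hence walks, written as powers \<open>adj E ^^ m\<close>; forbidden vertices and edges are
  expressed by shrinking E, and distinctness is restored only where a path or cycle has to be
  exhibited. The bound k \<ge> 5 comes from a cycle of H with two triple edges: two arcs of length
  at least k - 4 and the two edges give 2k - 6 \<ge> k - 1. It also gives G girth at least 5, which
  makes every non-cut vertex the centre of a reducible tripod and keeps the reduction simple.
  Insertion leaves the new vertices open and is unique only up to isomorphism, whereas reduction
  involves no choice; uniqueness is therefore argued on reductions.\<close>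

definition adj :: "'v set set \<Rightarrow> ('v \<times> 'v) set" where
  "adj E = {(x, y). {x, y} \<in> E}"

lemma adj_iff [simp]: "(x, y) \<in> adj E \<longleftrightarrow> {x, y} \<in> E"
  by (simp add: adj_def)

lemma sym_adj: "sym (adj E)"
  by (auto simp: sym_def insert_commute)

lemma adj_relpow_sym: "(x, y) \<in> adj E ^^ m \<Longrightarrow> (y, x) \<in> adj E ^^ m"
proof (induction m arbitrary: x)
  case (Suc m)
  then obtain z where "(x, z) \<in> adj E" "(z, y) \<in> adj E ^^ m"
    by (meson relpow_Suc_D2)
  then have "(y, z) \<in> adj E ^^ m" "(z, x) \<in> adj E"
    using Suc.IH by (auto simp: insert_commute)
  then show ?case
    by (rule relpow_Suc_I)
qed simp

lemma adj_relpow_mono: "E \<subseteq> F \<Longrightarrow> (x, y) \<in> adj E ^^ m \<Longrightarrow> (x, y) \<in> adj F ^^ m"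
proof (induction m arbitrary: x)
  case (Suc m)
  then obtain z where "(x, z) \<in> adj E" "(z, y) \<in> adj E ^^ m"
    by (meson relpow_Suc_D2)
  then have "(x, z) \<in> adj F" "(z, y) \<in> adj F ^^ m"
    using Suc.IH Suc.prems(1) by auto
  then show ?case
    by (rule relpow_Suc_I2)
qed simp

text \<open>Cutting at the traversal of an edge of S leaves two strictly shorter walks, the form
  needed for induction on the length. The pair (a, b) is oriented in the direction of
  travel.\<close>

lemma adj_relpow_split:
  assumes "(x, y) \<in> adj E ^^ m"
  shows "(x, y) \<in> adj (E - S) ^^ m \<or>
    (\<exists>a b i j. {a, b} \<in> E \<inter> S \<and> (x, a) \<in> adj E ^^ i \<and> (b, y) \<in> adj E ^^ j \<and> Suc (i + j) = m)"
  using assms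
proof (induction m arbitrary: x)
  case (Suc m)
  then obtain z where z: "{x, z} \<in> E" "(z, y) \<in> adj E ^^ m"
    by (metis adj_iff relpow_Suc_D2)
  show ?case
  proof (cases "{x, z} \<in> S")
    case True
    then show ?thesis
      using z by (intro disjI2 exI[of _ x] exI[of _ z] exI[of _ 0] exI[of _ m]) auto
  next
    case False
    from Suc.IH[OF z(2)] show ?thesis
    proof (elim disjE exE conjE)
      assume "(z, y) \<in> adj (E - S) ^^ m"
      then show ?thesis
        using z False by (intro disjI1 relpow_Suc_I2[of _ z]) auto
    next
      fix a b i j
      assume *: "{a, b} \<in> E \<inter> S" "(z, a) \<in> adj E ^^ i" "(b, y) \<in> adj E ^^ j" "Suc (i + j) = m"
      have "(x, a) \<in> adj E ^^ Suc i"
        by (rule relpow_Suc_I2[OF _ *(2)]) (use z in simp)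
      moreover have "Suc (Suc i + j) = Suc m"
        using *(4) by simp
      ultimately show ?thesis
        using *(1,3) by blast
    qed
  qed
qed simp

lemma walk_edges_simps [simp]:
  "walk_edges [] = {}"
  "walk_edges [a] = {}"
  "walk_edges (a # b # p) = insert {a, b} (walk_edges (b # p))"
proof -
  show "walk_edges (a # b # p) = insert {a, b} (walk_edges (b # p))"
  proof (intro set_eqI iffI)
    fix e assume "e \<in> walk_edges (a # b # p)"
    then obtain i where "e = {(a # b # p) ! i, (a # b # p) ! Suc i}" "Suc i < length (a # b # p)"
      unfolding walk_edges_def by blast
    then show "e \<in> insert {a, b} (walk_edges (b # p))"
      by (cases i) (auto simp: walk_edges_def)
  next
    fix e assume "e \<in> insert {a, b} (walk_edges (b # p))"
    then consider "e = {a, b}"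
      | i where "e = {(b # p) ! i, (b # p) ! Suc i}" "Suc i < length (b # p)"
      unfolding walk_edges_def by blast
    then show "e \<in> walk_edges (a # b # p)"
    proof cases
      case 1
      then show ?thesis
        unfolding walk_edges_def by (auto intro!: exI[of _ 0])
    next
      case 2
      then show ?thesis
        unfolding walk_edges_def by (auto intro!: exI[of _ "Suc i"])
    qed
  qed
qed (auto simp: walk_edges_def)

lemma walk_edges_append: "walk_edges (p @ a # q) = walk_edges (p @ [a]) \<union> walk_edges (a # q)"
proof (induction p)
  case (Cons x p)
  then show ?case by (cases p) auto
qed simp

lemma walk_edges_Cons: "p \<noteq> [] \<Longrightarrow> walk_edges (a # p) = insert {a, hd p} (walk_edges p)"
  by (cases p) auto

lemma walk_edges_snoc: "p \<noteq> [] \<Longrightarrow> walk_edges (p @ [a]) = insert {last p, a} (walk_edges p)"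
  by (induction p) (auto simp: walk_edges_Cons)

lemma in_walk_edges_subset: "e \<in> walk_edges p \<Longrightarrow> e \<subseteq> set p"
  by (auto simp: walk_edges_def)

lemma walk_edges_cover:
  assumes "2 \<le> length p" "v \<in> set p"
  shows "v \<in> \<Union> (walk_edges p)"
  using assms
proof (induction p)
  case (Cons a p)
  then obtain b q where "p = b # q"
    by (cases p) auto
  with Cons show ?case
    by (cases q) auto
qed simp

lemma walk_edges_nth_relpow:
  assumes "walk_edges p \<subseteq> E" "i \<le> j" "j < length p"
  shows "(p ! i, p ! j) \<in> adj E ^^ (j - i)"
  using assms(2,3)
proof (induction j)
  case (Suc j)
  show ?case
  proof (cases "i = Suc j")
    case False
    then have "(p ! i, p ! j) \<in> adj E ^^ (j - i)" "{p ! j, p ! Suc j} \<in> E"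
      using Suc assms(1) by (auto simp: walk_edges_def)
    then have "(p ! i, p ! Suc j) \<in> adj E ^^ Suc (j - i)"
      by auto
    then show ?thesis
      using False Suc.prems by (simp add: Suc_diff_le)
  qed simp
qed simp

lemma walk_edges_relpow:
  assumes "walk_edges p \<subseteq> E" "p \<noteq> []"
  shows "(hd p, last p) \<in> adj E ^^ (length p - 1)"
  using walk_edges_nth_relpow[OF assms(1), of 0 "length p - 1"] assms(2)
  by (simp add: hd_conv_nth last_conv_nth)

text \<open>Shortcutting: if the new first vertex already occurs on the path built so far,
  everything before that occurrence is dropped.\<close>

lemma relpow_imp_distinct_walk:
  assumes "(x, y) \<in> adj E ^^ m"
  obtains p where "p \<noteq> []" "distinct p" "hd p = x" "last p = y" "walk_edges p \<subseteq> E"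
    "length p \<le> Suc m"
proof -
  have "\<exists>p. p \<noteq> [] \<and> distinct p \<and> hd p = x \<and> last p = y \<and> walk_edges p \<subseteq> E \<and> length p \<le> Suc m"
    using assms
  proof (induction m arbitrary: x)
    case 0
    then show ?case by (intro exI[of _ "[x]"]) auto
  next
    case (Suc m)
    then obtain z where z: "{x, z} \<in> E" "(z, y) \<in> adj E ^^ m"
      by (metis adj_iff relpow_Suc_D2)
    from Suc.IH[OF z(2)] obtain p where p: "p \<noteq> []" "distinct p" "hd p = z" "last p = y"
      "walk_edges p \<subseteq> E" "length p \<le> Suc m"
      by blast
    show ?case
    proof (cases "x \<in> set p")
      case True
      then obtain q r where "p = q @ x # r"
        by (meson split_list)
      with p show ?thesis
        using walk_edges_append[of q x r] by (intro exI[of _ "x # r"]) auto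
    next
      case False
      with p z show ?thesis
        by (intro exI[of _ "x # p"]) (auto simp: walk_edges_Cons)
    qed
  qed
  then show thesis
    using that by blast
qed

lemma cycle_edges_rotate: "cycle_edges (p @ q) = cycle_edges (q @ p)"
proof (cases "p = [] \<or> q = []")
  case False
  then obtain a p' b q' where "p = a # p'" "q = b # q'"
    by (meson neq_Nil_conv)
  then show ?thesis
    using walk_edges_append[of "a # p'" b "q' @ [a]"] walk_edges_append[of "b # q'" a "p' @ [b]"]
    by (simp add: cycle_edges_def Un_commute)
qed auto

lemma is_cycle_rotate: "is_cycle G (p @ q) \<Longrightarrow> is_cycle G (q @ p)"
  by (auto simp: is_cycle_def cycle_edges_rotate[of q p])

lemma cycle_vertex_first:
  assumes "is_cycle G z" "w \<in> set z"
  obtains p where "is_cycle G (w # p)" "length (w # p) = length z" "set (w # p) = set z"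
proof -
  obtain q r where "z = q @ w # r"
    using assms(2) by (meson split_list)
  with assms(1) show thesis
    using that[of "r @ q"] is_cycle_rotate[of G q "w # r"] by auto
qed

lemma cycle_edges_conv: "z \<noteq> [] \<Longrightarrow> cycle_edges z = insert {last z, hd z} (walk_edges z)"
  by (simp add: cycle_edges_def walk_edges_snoc)

lemma is_cycle_ConsD:
  assumes "is_cycle G (w # p)"
  shows "2 \<le> length p" "p \<noteq> []" "distinct p" "w \<notin> set p" "walk_edges p \<subseteq> edges G"
    "{w, hd p} \<in> edges G" "{w, last p} \<in> edges G" "hd p \<noteq> last p"
proof -
  show *: "2 \<le> length p" "p \<noteq> []" "distinct p" "w \<notin> set p"
    using assms by (auto simp: is_cycle_def)
  show "walk_edges p \<subseteq> edges G" "{w, hd p} \<in> edges G" "{w, last p} \<in> edges G"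
    using assms *(2) by (auto simp: is_cycle_def cycle_edges_conv walk_edges_Cons insert_commute)
  show "hd p \<noteq> last p"
    using * by (cases p) auto
qed

lemma in_walk_edges_split:
  assumes "e \<in> walk_edges p"
  obtains q a b r where "p = q @ a # b # r" "e = {a, b}"
proof -
  obtain i where "e = {p ! i, p ! Suc i}" "Suc i < length p"
    using assms by (auto simp: walk_edges_def)
  moreover have "p = take i p @ p ! i # p ! Suc i # drop (Suc (Suc i)) p"
    using \<open>Suc i < length p\<close> by (simp add: Cons_nth_drop_Suc)
  ultimately show thesis
    using that by blast
qed

text \<open>Rotation makes any chosen edge the closing edge; what remains in
  \<open>walk_edges p\<close> is then a walk between its ends that avoids it.\<close>

lemma cycle_edge_last:
  assumes "is_cycle G z" "e \<in> cycle_edges z"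
  obtains p where "is_cycle G p" "length p = length z" "cycle_edges p = cycle_edges z"
    "e = {hd p, last p}" "e \<notin> walk_edges p"
proof -
  have z: "z \<noteq> []"
    using assms(1) by (auto simp: is_cycle_def)
  obtain p where p: "is_cycle G p" "length p = length z" "cycle_edges p = cycle_edges z"
    "e = {hd p, last p}"
  proof (cases "e = {last z, hd z}")
    case True
    then show ?thesis
      using assms(1) by (intro that[of z]) auto
  next
    case False
    then have "e \<in> walk_edges z"
      using assms(2) z by (simp add: cycle_edges_conv)
    then obtain q a b r where "z = q @ a # b # r" "e = {a, b}"
      by (rule in_walk_edges_split)
    then show ?thesis
      using assms(1) is_cycle_rotate[of G "q @ [a]" "b # r"]
        cycle_edges_rotate[of "q @ [a]" "b # r"]
      by (intro that[of "(b # r) @ (q @ [a])"]) auto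
  qed
  \<comment> \<open>A second traversal would make the first and last vertices consecutive in a list
    of distinct vertices, which forces length 2.\<close>
  moreover have "e \<notin> walk_edges p"
  proof
    assume "e \<in> walk_edges p"
    then obtain i where i: "e = {p ! i, p ! Suc i}" "Suc i < length p"
      by (auto simp: walk_edges_def)
    have p': "distinct p" "3 \<le> length p" "p \<noteq> []"
      using p(1) by (auto simp: is_cycle_def)
    have "{p ! i, p ! Suc i} = {p ! 0, p ! (length p - 1)}"
      using p(4) i(1) p'(3) by (simp add: hd_conv_nth last_conv_nth)
    moreover have "p ! Suc i \<noteq> p ! 0"
      using p' i(2) by (subst nth_eq_iff_index_eq) auto
    ultimately have "p ! Suc i = p ! (length p - 1)" "p ! i = p ! 0"
      by (auto simp: doubleton_eq_iff)
    then have "Suc i = length p - 1" "i = 0"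
      using p' i(2) by (auto simp: nth_eq_iff_index_eq)
    then show False
      using p'(2) by simp
  qed
  ultimately show thesis
    using that by blast
qed

section \<open>Simple graphs, connectivity by walks, and cycles obtained from walks\<close>

lemma simple_graphD:
  assumes "simple_graph G"
  shows "finite (verts G)" "e \<in> edges G \<Longrightarrow> e \<subseteq> verts G" "e \<in> edges G \<Longrightarrow> card e = 2"
    "{x, y} \<in> edges G \<Longrightarrow> x \<noteq> y" "{x, y} \<in> edges G \<Longrightarrow> x \<in> verts G" "{x, y} \<in> edges G \<Longrightarrow> y \<in> verts G"
proof -
  show "x \<noteq> y" if "{x, y} \<in> edges G"
  proof
    assume "x = y"
    with that have "card {x, x} = 2"
      using assms by (auto simp: simple_graph_def)
    then show False by simp
  qed
qed (use assms in \<open>auto simp: simple_graph_def\<close>)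

lemma walk_vertices_subset:
  assumes "simple_graph G" "walk_edges p \<subseteq> edges G" "hd p \<in> verts G"
  shows "set p \<subseteq> verts G"
proof (cases "2 \<le> length p")
  case True
  then show ?thesis
    using assms walk_edges_cover[OF True] by (fastforce simp: simple_graph_def)
next
  case False
  then show ?thesis
    using assms(3) by (cases p) (auto simp: Suc_le_eq)
qed

lemma joined_iff:
  assumes "simple_graph G"
  shows "joined G u v \<longleftrightarrow> u \<in> verts G \<and> (u, v) \<in> (adj (edges G))\<^sup>*"
proof
  assume "joined G u v"
  then obtain p where "is_path G p" "hd p = u" "last p = v"
    by (auto simp: joined_def)
  then show "u \<in> verts G \<and> (u, v) \<in> (adj (edges G))\<^sup>*"
    using walk_edges_relpow[of p "edges G"] hd_in_set[of p]
    by (auto simp: is_path_def intro: relpow_imp_rtrancl)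
next
  assume *: "u \<in> verts G \<and> (u, v) \<in> (adj (edges G))\<^sup>*"
  then obtain m where "(u, v) \<in> adj (edges G) ^^ m"
    by (meson rtrancl_imp_relpow)
  then obtain p where "p \<noteq> []" "distinct p" "hd p = u" "last p = v" "walk_edges p \<subseteq> edges G"
    by (rule relpow_imp_distinct_walk)
  with * show "joined G u v"
    using walk_vertices_subset[OF assms, of p] by (auto simp: joined_def is_path_def)
qed

lemma girth_ge_iff: "enat k \<le> girth G \<longleftrightarrow> (\<forall>z. is_cycle G z \<longrightarrow> k \<le> length z)"
  by (auto simp: girth_def le_INF_iff)

text \<open>A detour around an edge contains a path between its ends, and the edge closes that path
  to a cycle.\<close>

lemma cycle_through_edge:
  assumes "simple_graph G" "{x, y} \<in> edges G" "(x, y) \<in> adj (edges G - {{x, y}}) ^^ m"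
  obtains z where "is_cycle G z" "length z \<le> Suc m"
proof -
  obtain p where p: "p \<noteq> []" "distinct p" "hd p = x" "last p = y"
    "walk_edges p \<subseteq> edges G - {{x, y}}" "length p \<le> Suc m"
    using assms(3) by (rule relpow_imp_distinct_walk)
  have xy: "x \<noteq> y" "x \<in> verts G"
    using simple_graphD[OF assms(1)] assms(2) by auto
  \<comment> \<open>One vertex would mean x = y, and two vertices would use the removed
    edge.\<close>
  have "3 \<le> length p"
  proof (rule ccontr)
    assume "\<not> 3 \<le> length p"
    then have "length p = 1 \<or> length p = 2"
      using p(1) by (simp add: not_le numeral_eq_Suc less_Suc_eq)
    then show False
      using p xy by (auto simp: length_Suc_conv numeral_2_eq_2)
  qed
  moreover have "set p \<subseteq> verts G"
    using walk_vertices_subset[OF assms(1), of p] p xy by auto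
  ultimately have "is_cycle G p"
    using p assms(2) by (auto simp: is_cycle_def cycle_edges_conv insert_commute)
  with p show thesis
    using that by blast
qed

text \<open>The walk uses no edge at w, so the path extracted from it misses w and can be closed
  through w by two edges.\<close>

lemma cycle_through_vertex:
  assumes "simple_graph G" "{w, x} \<in> edges G" "{w, y} \<in> edges G" "x \<noteq> y"
    and "(x, y) \<in> adj {e \<in> edges G. w \<notin> e} ^^ m"
  obtains z where "is_cycle G z" "length z \<le> m + 2"
proof -
  obtain p where p: "p \<noteq> []" "distinct p" "hd p = x" "last p = y"
    "walk_edges p \<subseteq> {e \<in> edges G. w \<notin> e}" "length p \<le> Suc m"
    using assms(5) by (rule relpow_imp_distinct_walk)
  have "2 \<le> length p"
    using p assms(4) by (cases p) (auto simp: Suc_le_eq)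
  moreover have "w \<notin> set p"
    using walk_edges_cover[OF \<open>2 \<le> length p\<close>, of w] p(5) by blast
  moreover have "set p \<subseteq> verts G"
    using p simple_graphD[OF assms(1)] assms(2) by (intro walk_vertices_subset[OF assms(1)]) auto
  ultimately have "is_cycle G (w # p)"
    using p assms simple_graphD[OF assms(1)]
    by (auto simp: is_cycle_def cycle_edges_conv walk_edges_Cons insert_commute)
  with p show thesis
    using that by fastforce
qed

section \<open>The distance between edges\<close>

lemma edge_other_end:
  assumes "card e = 2" "x \<in> e"
  obtains x' where "e = {x, x'}" "x \<noteq> x'"
  using assms by (auto simp: card_2_iff doubleton_eq_iff)

text \<open>A path from x to y is prolonged at both ends by e and e' to a path with at most m + 2
  edges, which the distance bounds below by k - 2. This fails if the other end x' or y' already lies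
  on the path or x' = y'; in each of these cases there is a shorter walk between the two edges, or
  the edges coincide, so induction on m applies.\<close>

lemma edge_dist_le_walk:
  assumes H: "simple_graph H" and e: "e \<in> edges H" "e' \<in> edges H" "e \<noteq> e'"
    and k: "5 \<le> k" "enat (k - 2) \<le> edge_dist H e e'"
    and "x \<in> e" "y \<in> e'" "(x, y) \<in> adj (edges H) ^^ m"
  shows "k \<le> m + 4"
  using assms(7-9)
proof (induction m arbitrary: x y rule: less_induct)
  case (less m)
  obtain p where p: "p \<noteq> []" "distinct p" "hd p = x" "last p = y"
    "walk_edges p \<subseteq> edges H" "length p \<le> Suc m"
    using less.prems(3) by (rule relpow_imp_distinct_walk)
  obtain x' where x': "e = {x, x'}" "x \<noteq> x'"
    using edge_other_end less.prems(1) simple_graphD(3)[OF H e(1)] by metis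
  obtain y' where y': "e' = {y, y'}" "y \<noteq> y'"
    using edge_other_end less.prems(2) simple_graphD(3)[OF H e(2)] by metis
  have IH: "k \<le> m + 4" if "u \<in> e" "v \<in> e'" "(u, v) \<in> adj (edges H) ^^ i" "i < m" for u v i
    using less.IH[OF that(4,1-3)] that(4) by simp
  consider "x' \<in> set p" | "y' \<in> set p" | "x' = y'" | "x' \<notin> set p" "y' \<notin> set p" "x' \<noteq> y'"
    by blast
  then show ?case
  proof cases
    case 1
    then obtain i where i: "i < length p" "p ! i = x'"
      by (auto simp: in_set_conv_nth)
    then have "i \<noteq> 0"
      using p(1,3) x'(2) by (metis hd_conv_nth)
    have "(x', y) \<in> adj (edges H) ^^ (length p - 1 - i)"
      using walk_edges_nth_relpow[OF p(5), of i "length p - 1"] i p(1,4)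
      by (simp add: last_conv_nth)
    then show ?thesis
      using IH[of x' y "length p - 1 - i"] x' less.prems(2) \<open>i \<noteq> 0\<close> i p(6) by auto
  next
    case 2
    then obtain i where i: "i < length p" "p ! i = y'"
      by (auto simp: in_set_conv_nth)
    then have "i \<noteq> length p - 1"
      using p(1,4) y'(2) by (metis last_conv_nth)
    have "(x, y') \<in> adj (edges H) ^^ i"
      using walk_edges_nth_relpow[OF p(5), of 0 i] i p(1,3)
      by (simp add: hd_conv_nth)
    then show ?thesis
      using IH[of x y' i] y' less.prems(1) \<open>i \<noteq> length p - 1\<close> i p(6) by auto
  next
    \<comment> \<open>A common end gives a walk of length 0, available to the induction only if m is
      positive; for m = 0 both pairs of ends agree and e = e'.\<close>
    case 3
    show ?thesis
    proof (cases "m = 0")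
      case True
      then have "x = y"
        using less.prems(3) by simp
      with 3 x' y' e(3) show ?thesis by simp
    next
      case False
      then have "k \<le> 0 + 4"
        using less.IH[of 0 x' y'] x' y' 3 by auto
      then show ?thesis by simp
    qed
  next
    case 4
    have "is_path H (x' # p @ [y'])"
      using 4 p x' y' e walk_vertices_subset[OF H p(5)] simple_graphD[OF H]
      by (auto simp: is_path_def walk_edges_Cons walk_edges_snoc insert_commute)
    moreover have "e \<in> walk_edges (x' # p @ [y'])" "e' \<in> walk_edges (x' # p @ [y'])"
      using p x' y' by (auto simp: walk_edges_Cons walk_edges_snoc insert_commute)
    ultimately have "edge_dist H e e' \<le> enat (length (x' # p @ [y']) - 1)"
      unfolding edge_dist_def by (intro INF_lower) auto
    with k(2) have "enat (k - 2) \<le> enat (length (x' # p @ [y']) - 1)"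
      by (rule order.trans)
    then show ?thesis
      using p(6) by simp
  qed
qed

text \<open>The converse direction: on a path containing both edges, the stretch strictly between
  them is a walk from one to the other, and the two edges themselves account for the difference
  between k - 4 and k - 2.\<close>

lemma edge_dist_geI:
  assumes "e \<noteq> e'"
    and walk: "\<And>x y m. x \<in> e \<Longrightarrow> y \<in> e' \<Longrightarrow> (x, y) \<in> adj (edges H) ^^ m \<Longrightarrow> k \<le> m + 4"
  shows "enat (k - 2) \<le> edge_dist H e e'"
  unfolding edge_dist_def
proof (intro INF_greatest)
  fix p assume "p \<in> {p. is_path H p \<and> e \<in> walk_edges p \<and> e' \<in> walk_edges p}"
  then have p: "walk_edges p \<subseteq> edges H" "e \<in> walk_edges p" "e' \<in> walk_edges p"
    by (auto simp: is_path_def)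
  then obtain i j where i: "e = {p ! i, p ! Suc i}" "Suc i < length p"
    and j: "e' = {p ! j, p ! Suc j}" "Suc j < length p"
    unfolding walk_edges_def by blast
  consider "i < j" | "j < i" | "i = j"
    by linarith
  then show "enat (k - 2) \<le> enat (length p - 1)"
  proof cases
    case 1
    then have "k \<le> j - Suc i + 4"
      using walk_edges_nth_relpow[OF p(1), of "Suc i" j] i j by (intro walk[of "p ! Suc i" "p ! j"]) auto
    then show ?thesis
      using j 1 by simp
  next
    case 2
    then have "k \<le> i - Suc j + 4"
      using adj_relpow_sym[OF walk_edges_nth_relpow[OF p(1), of "Suc j" i]] i j
      by (intro walk[of "p ! i" "p ! Suc j"]) auto
    then show ?thesis
      using i 2 by simp
  next
    case 3
    then show ?thesis
      using assms(1) i j by simp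
  qed
qed

lemma min_triple_dist_ge_iff:
  assumes "card T = 3"
  shows "enat d \<le> min_triple_dist G T \<longleftrightarrow> (\<forall>e\<in>T. \<forall>e'\<in>T. e \<noteq> e' \<longrightarrow> enat d \<le> edge_dist G e e')"
proof -
  have T: "finite T"
    using assms by (intro card_ge_0_finite) simp
  let ?D = "{edge_dist G e e' | e e'. e \<in> T \<and> e' \<in> T \<and> e \<noteq> e'}"
  have "?D \<subseteq> (\<lambda>(e, e'). edge_dist G e e') ` (T \<times> T)"
    by auto
  then have "finite ?D"
    by (rule finite_subset) (use T in auto)
  moreover have "?D \<noteq> {}"
    using assms by (auto simp: card_Suc_eq numeral_3_eq_3)
  ultimately show ?thesis
    unfolding min_triple_dist_def by (subst Min_ge_iff) auto
qed

section \<open>The tripod operation\<close>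

text \<open>Here the subdividing map \<open>s\<close>, existentially quantified in
  \<open>tripod_insertion\<close>, is a parameter, so that the new vertices can be named.\<close>

locale tripod =
  fixes H :: "'v graph" and T :: "'v set set" and G :: "'v graph" and c :: 'v and s :: "'v set \<Rightarrow> 'v"
  assumes simple_H: "simple_graph H"
    and triple: "edge_triple H T"
    and inj_s: "inj_on s T"
    and s_new: "e \<in> T \<Longrightarrow> s e \<notin> verts H"
    and c_new: "c \<notin> verts H" "e \<in> T \<Longrightarrow> s e \<noteq> c"
    and G_eq: "G = \<lparr>verts = verts H \<union> s ` T \<union> {c},
      edges = (edges H - T) \<union> {{u, s e} | u e. e \<in> T \<and> u \<in> e} \<union> {{c, s e} | e. e \<in> T}\<rparr>"

lemma tripod_insertion_iff:
  assumes "simple_graph H"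
  shows "tripod_insertion H T G c \<longleftrightarrow> (\<exists>s. tripod H T G c s)"
proof
  assume "tripod_insertion H T G c"
  then obtain s where s: "edge_triple H T" "inj_on s T" "s ` T \<inter> verts H = {}" "c \<notin> verts H \<union> s ` T"
    "G = \<lparr>verts = verts H \<union> s ` T \<union> {c},
      edges = (edges H - T) \<union> {{u, s e} | u e. e \<in> T \<and> u \<in> e} \<union> {{c, s e} | e. e \<in> T}\<rparr>"
    unfolding tripod_insertion_def by blast
  have "tripod H T G c s"
  proof (unfold_locales)
    show "s e \<notin> verts H" if "e \<in> T" for e
      using that s(3) by blast
    show "s e \<noteq> c" if "e \<in> T" for e
      using that s(4) by blast
  qed (use assms s in auto)
  then show "\<exists>s. tripod H T G c s"
    by blast
next
  assume "\<exists>s. tripod H T G c s"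
  then obtain s where "tripod H T G c s"
    by blast
  then interpret tripod H T G c s .
  show "tripod_insertion H T G c"
    unfolding tripod_insertion_def using triple inj_s s_new c_new G_eq
    by (intro conjI exI[of _ s]) auto
qed

context tripod
begin

lemma T_edges: "e \<in> T \<Longrightarrow> e \<in> edges H" "e \<in> T \<Longrightarrow> e \<subseteq> verts H" "e \<in> T \<Longrightarrow> card e = 2"
  using triple simple_H unfolding edge_triple_def simple_graph_def by blast+

lemma card_T: "card T = 3" and finite_T: "finite T"
  using triple by (auto simp: edge_triple_def intro: card_ge_0_finite)

lemma verts_G: "verts G = verts H \<union> s ` T \<union> {c}"
  by (simp add: G_eq)

lemma edges_G: "edges G = (edges H - T) \<union> {{u, s e} | u e. e \<in> T \<and> u \<in> e} \<union> {{c, s e} | e. e \<in> T}"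
  by (simp add: G_eq)

lemma s_eq_iff: "e \<in> T \<Longrightarrow> e' \<in> T \<Longrightarrow> s e = s e' \<longleftrightarrow> e = e'"
  using inj_s by (auto simp: inj_on_def)

lemma edge_old_iff:
  assumes "u \<in> verts H" "v \<in> verts H"
  shows "{u, v} \<in> edges G \<longleftrightarrow> {u, v} \<in> edges H - T"
  using assms s_new c_new by (auto simp: edges_G doubleton_eq_iff)

lemma edge_subdiv_iff:
  assumes "e \<in> T"
  shows "{s e, x} \<in> edges G \<longleftrightarrow> x \<in> insert c e"
proof
  assume "{s e, x} \<in> edges G"
  moreover have "{s e, x} \<notin> edges H"
    using s_new[OF assms] simple_graphD(2)[OF simple_H] by blast
  ultimately show "x \<in> insert c e"
    using assms s_new c_new T_edges(2) s_eq_iff unfolding edges_G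
    by (auto simp: doubleton_eq_iff subset_iff)
next
  assume "x \<in> insert c e"
  with assms show "{s e, x} \<in> edges G"
    unfolding edges_G by (auto simp: insert_commute)
qed

lemma edge_centre_iff: "{c, x} \<in> edges G \<longleftrightarrow> x \<in> s ` T"
proof
  assume "{c, x} \<in> edges G"
  moreover have "{c, x} \<notin> edges H"
    using c_new simple_graphD(2)[OF simple_H] by blast
  ultimately show "x \<in> s ` T"
    using c_new T_edges(2) unfolding edges_G
    by (auto simp: doubleton_eq_iff subset_iff)
qed (auto simp: edges_G)

lemma nbrs_centre: "nbrs G c = s ` T"
  by (auto simp: nbrs_def edge_centre_iff)

lemma nbrs_subdiv: "e \<in> T \<Longrightarrow> nbrs G (s e) = insert c e"
  by (auto simp: nbrs_def edge_subdiv_iff)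

lemma simple_G: "simple_graph G"
proof -
  have "card {u, s e} = 2" if "e \<in> T" "u \<in> e" for u e
  proof -
    have "u \<noteq> s e"
      using that s_new T_edges(2) by blast
    then show ?thesis by simp
  qed
  moreover have "card {c, s e} = 2" if "e \<in> T" for e
    using c_new(2)[OF that] by auto
  moreover have "finite (verts G)"
    using simple_graphD(1)[OF simple_H] finite_T by (simp add: verts_G)
  moreover have "e \<subseteq> verts G" if "e \<in> edges G" for e
    using that simple_graphD(2)[OF simple_H] T_edges(2) by (auto simp: verts_G edges_G)
  ultimately show ?thesis
    unfolding simple_graph_def using simple_graphD(3)[OF simple_H] by (auto simp: edges_G)
qed

lemma card_verts_G: "card (verts G) = card (verts H) + 4"
proof -
  have "card (s ` T) = 3"
    using card_image[OF inj_s] card_T by simp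
  moreover have "card (verts H \<union> s ` T) = card (verts H) + card (s ` T)"
    using simple_graphD(1)[OF simple_H] finite_T s_new by (intro card_Un_disjoint) auto
  moreover have "card (insert c (verts H \<union> s ` T)) = Suc (card (verts H \<union> s ` T))"
    using simple_graphD(1)[OF simple_H] finite_T c_new by (intro card_insert_disjoint) auto
  ultimately show ?thesis
    by (simp add: verts_G)
qed

text \<open>An old vertex keeps its degree because each neighbour across a triple edge is exchanged
  for the vertex subdividing that edge.\<close>

lemma card_nbrs_old:
  assumes v: "v \<in> verts H"
  shows "card (nbrs G v) = card (nbrs H v)"
proof -
  let ?f = "\<lambda>w. if {v, w} \<in> T then s {v, w} else w"
  have "bij_betw ?f (nbrs H v) (nbrs G v)"
    unfolding bij_betw_def
  proof
    show "inj_on ?f (nbrs H v)"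
    proof (rule inj_onI)
      fix w w' assume w: "w \<in> nbrs H v" "w' \<in> nbrs H v" "?f w = ?f w'"
      have "w \<in> verts H" "w' \<in> verts H"
        using w simple_graphD(6)[OF simple_H] by (auto simp: nbrs_def)
      then have "{v, w} \<in> T \<Longrightarrow> s {v, w} \<noteq> w'" "{v, w'} \<in> T \<Longrightarrow> s {v, w'} \<noteq> w"
        using s_new by metis+
      moreover have "w = w'" if "{v, w} = {v, w'}"
        using that by (auto simp: doubleton_eq_iff)
      ultimately show "w = w'"
        using w(3) s_eq_iff[of "{v, w}" "{v, w'}"] by (simp split: if_splits)
    qed
    show "?f ` nbrs H v = nbrs G v"
    proof (intro equalityI subsetI)
      fix x assume "x \<in> ?f ` nbrs H v"
      then obtain w where w: "{v, w} \<in> edges H" "x = ?f w"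
        by (auto simp: nbrs_def)
      have "w \<in> verts H"
        using w simple_graphD(6)[OF simple_H] by auto
      show "x \<in> nbrs G v"
      proof (cases "{v, w} \<in> T")
        case True
        then show ?thesis
          using edge_subdiv_iff[OF True, of v] w(2) by (simp add: nbrs_def insert_commute)
      next
        case False
        then show ?thesis
          using edge_old_iff[OF v \<open>w \<in> verts H\<close>] w by (simp add: nbrs_def)
      qed
    next
      fix x assume "x \<in> nbrs G v"
      then have x: "{v, x} \<in> edges G" by (simp add: nbrs_def)
      then have "x \<in> verts G"
        using simple_graphD(6)[OF simple_G] by blast
      then consider "x = c" | e where "e \<in> T" "x = s e" | "x \<in> verts H"
        by (auto simp: verts_G)
      then show "x \<in> ?f ` nbrs H v"
      proof cases
        case 1
        then show ?thesis
          using x edge_centre_iff[of v] s_new v by (auto simp: insert_commute)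
      next
        case 2
        then have "v \<in> e"
          using x edge_subdiv_iff[of e v] c_new(1) v by (auto simp: insert_commute)
        then obtain w where "e = {v, w}"
          using edge_other_end[OF T_edges(3)] 2(1) by metis
        then have "x = ?f w" "w \<in> nbrs H v"
          using 2 T_edges(1)[OF 2(1)] by (simp_all add: nbrs_def)
        then show ?thesis
          by (rule image_eqI)
      next
        case 3
        then have "x = ?f x" "x \<in> nbrs H v"
          using x edge_old_iff[OF v 3] by (simp_all add: nbrs_def)
        then show ?thesis
          by (rule image_eqI)
      qed
    qed
  qed
  then show ?thesis
    using bij_betw_same_card[of ?f "nbrs H v" "nbrs G v"] by argo
qed

lemma cubic_iff: "cubic G \<longleftrightarrow> cubic H"
proof -
  have "card (nbrs G c) = 3"
    using card_image[OF inj_s] card_T by (simp add: nbrs_centre)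
  moreover have "card (nbrs G (s e)) = 3" if "e \<in> T" for e
  proof -
    have "finite e" "c \<notin> e"
      using T_edges(2,3)[OF that] c_new(1) by (auto intro: card_ge_0_finite)
    then show ?thesis
      using T_edges(3)[OF that] by (simp add: nbrs_subdiv[OF that])
  qed
  ultimately show ?thesis
    unfolding cubic_def using simple_G simple_H card_nbrs_old by (auto simp: verts_G)
qed

text \<open>Two steps through a subdividing vertex become one step along the original edge, or none if
  the walk turns back there.\<close>

lemma walk_contract:
  assumes "x \<in> verts H" "y \<in> verts H"
    and "(x, y) \<in> adj {e \<in> edges G. e \<inter> insert c (s ` (S \<inter> T)) = {}} ^^ m"
  obtains m' where "m' \<le> m" "(x, y) \<in> adj (edges H - S \<inter> T) ^^ m'"
proof -
  \<comment> \<open>The parameter \<open>S\<close> selects triple edges whose subdividing vertices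
    are forbidden in addition to c. With \<open>S = {}\<close> only c is avoided; with
    \<open>S = {e}\<close> the contracted walk also avoids the edge e, as needed for closing it by
    e.\<close>
  let ?E = "{e \<in> edges G. e \<inter> insert c (s ` (S \<inter> T)) = {}}"
  have "\<exists>m'\<le>m. (x, y) \<in> adj (edges H - S \<inter> T) ^^ m'"
    using assms(1,3)
  proof (induction m arbitrary: x rule: less_induct)
    case (less m)
    show ?case
    proof (cases m)
      case 0
      then show ?thesis
        using less.prems by (auto intro: exI[of _ 0])
    next
      case (Suc m1)
      then obtain z where z: "(x, z) \<in> adj ?E" "(z, y) \<in> adj ?E ^^ m1"
        using less.prems(2) by (meson relpow_Suc_D2)
      then have xz: "{x, z} \<in> edges G" "z \<noteq> c" "z \<notin> s ` (S \<inter> T)"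
        by auto
      then have "z \<in> verts G"
        using simple_graphD(6)[OF simple_G] by blast
      then consider "z \<in> verts H" | e where "e \<in> T" "z = s e"
        using xz(2) by (auto simp: verts_G)
      then show ?thesis
      proof cases
        case 1
        then obtain m' where m': "m' \<le> m1" "(z, y) \<in> adj (edges H - S \<inter> T) ^^ m'"
          using less.IH[of m1 z] z(2) Suc by auto
        have "(x, z) \<in> adj (edges H - S \<inter> T)"
          using xz edge_old_iff[OF less.prems(1) 1] by auto
        then have "(x, y) \<in> adj (edges H - S \<inter> T) ^^ Suc m'"
          using m'(2) by (rule relpow_Suc_I2)
        then show ?thesis
          using m'(1) Suc by (intro exI[of _ "Suc m'"]) simp
      next
        case 2
        \<comment> \<open>The target y is an old vertex, so the walk cannot end at the subdividing
          vertex z and has a further step, which leads to an end of e.\<close>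
        have "x \<noteq> c" "z \<noteq> y"
          using less.prems(1) c_new(1) 2 s_new assms(2) by auto
        then obtain m2 where "m1 = Suc m2"
          using z(2) by (cases m1) auto
        moreover obtain x' where "(z, x') \<in> adj ?E" "(x', y) \<in> adj ?E ^^ m2"
          using z(2) unfolding \<open>m1 = Suc m2\<close> by (rule relpow_Suc_E2)
        ultimately have m2: "m1 = Suc m2" "(z, x') \<in> adj ?E" "(x', y) \<in> adj ?E ^^ m2"
          by blast+
        have "x \<in> e" "x' \<in> e"
          using m2(2) xz(1) 2 edge_subdiv_iff[OF 2(1)] \<open>x \<noteq> c\<close> by (auto simp: insert_commute)
        have "x' \<in> verts H"
          using \<open>x' \<in> e\<close> 2 T_edges(2) by blast
        then obtain m' where m': "m' \<le> m2" "(x', y) \<in> adj (edges H - S \<inter> T) ^^ m'"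
          using less.IH[of m2 x'] m2 Suc by auto
        show ?thesis
        proof (cases "x = x'")
          case True
          then show ?thesis
            using m' m2(1) Suc by (intro exI[of _ m']) simp
        next
          case False
          then have "e = {x, x'}"
            using \<open>x \<in> e\<close> \<open>x' \<in> e\<close> T_edges(3)[OF 2(1)] by (auto simp: card_2_iff)
          moreover have "e \<notin> S"
            using xz(3) 2 by auto
          ultimately have "(x, x') \<in> adj (edges H - S \<inter> T)"
            using T_edges(1)[OF 2(1)] by auto
          then have "(x, y) \<in> adj (edges H - S \<inter> T) ^^ Suc m'"
            using m'(2) by (rule relpow_Suc_I2)
          then show ?thesis
            using m'(1) m2(1) Suc by (intro exI[of _ "Suc m'"]) simp
        qed
      qed
    qed
  qed
  then show thesis
    using that by blast
qed

lemma old_edges_subset: "edges H - T \<subseteq> {e \<in> edges G. e \<inter> insert c (s ` T) = {}}"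
  using simple_graphD(2)[OF simple_H] c_new(1) s_new unfolding edges_G by blast

text \<open>An edge of H survives in G or becomes two edges through its subdividing vertex; neither
  route uses c.\<close>

lemma adj_subset_rtrancl: "adj (edges H) \<subseteq> (adj {e \<in> edges G. c \<notin> e})\<^sup>*"
proof
  fix p assume "p \<in> adj (edges H)"
  then obtain x y where p: "p = (x, y)" "{x, y} \<in> edges H"
    by (cases p) auto
  let ?E = "{e \<in> edges G. c \<notin> e}"
  have xy: "x \<noteq> c" "y \<noteq> c"
    using p(2) simple_graphD[OF simple_H] c_new(1) by blast+
  show "p \<in> (adj ?E)\<^sup>*"
  proof (cases "{x, y} \<in> T")
    case True
    have "(x, s {x, y}) \<in> adj ?E" "(s {x, y}, y) \<in> adj ?E"
      using edge_subdiv_iff[OF True, of x] edge_subdiv_iff[OF True, of y] c_new(2)[OF True] xy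
      by (auto simp: insert_commute)
    then show ?thesis
      unfolding p(1) by (meson r_into_rtrancl rtrancl_trans)
  next
    case False
    then have "(x, y) \<in> adj ?E"
      using p(2) old_edges_subset by auto
    then show ?thesis
      unfolding p(1) by (rule r_into_rtrancl)
  qed
qed

lemma connected_G:
  assumes "connected_graph H"
  shows "connected_graph G"
proof -
  let ?R = "(adj (edges G))\<^sup>*"
  have sym: "sym ?R"
    using sym_adj by (rule sym_rtrancl)
  have "adj {e \<in> edges G. c \<notin> e} \<subseteq> adj (edges G)"
    by auto
  then have mono: "(adj {e \<in> edges G. c \<notin> e})\<^sup>* \<subseteq> ?R"
    by (rule rtrancl_mono)
  have H: "(x, y) \<in> ?R" if "x \<in> verts H" "y \<in> verts H" for x y
  proof -
    have "(x, y) \<in> (adj (edges H))\<^sup>*"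
      using assms that by (auto simp: connected_graph_def joined_iff[OF simple_H])
    then show ?thesis
      using rtrancl_mono[OF adj_subset_rtrancl] mono by auto
  qed
  obtain r where r: "r \<in> verts H"
    using assms by (auto simp: connected_graph_def)
  have sub: "(s e, r) \<in> ?R" if "e \<in> T" for e
  proof -
    have "e \<noteq> {}" "e \<subseteq> verts H"
      using T_edges(2,3)[OF that] by auto
    then obtain x where x: "x \<in> e" "x \<in> verts H"
      by blast
    have "(s e, x) \<in> adj (edges G)"
      using edge_subdiv_iff[OF that] x by simp
    then show ?thesis
      using H[OF x(2) r] by (rule converse_rtrancl_into_rtrancl)
  qed
  obtain e where "e \<in> T"
    using card_T by fastforce
  then have "(c, s e) \<in> adj (edges G)"
    using edge_centre_iff by auto
  then have "(c, r) \<in> ?R"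
    using sub[OF \<open>e \<in> T\<close>] by (rule converse_rtrancl_into_rtrancl)
  then have "(x, r) \<in> ?R" if "x \<in> verts G" for x
    using that H r sub by (auto simp: verts_G)
  then have "(x, y) \<in> ?R" if "x \<in> verts G" "y \<in> verts G" for x y
    using that sym by (meson rtrancl_trans symD)
  then show ?thesis
    by (auto simp: connected_graph_def joined_iff[OF simple_G] verts_G)
qed

text \<open>If c is not a cut vertex, old vertices are joined in G by walks avoiding c, and these
  contract to walks of H.\<close>

lemma connected_H:
  assumes "connected_graph G" "\<not> cut_vertex G c"
  shows "connected_graph H"
proof -
  let ?D = "delete_vertex G c"
  have D: "simple_graph ?D"
    using simple_G by (auto simp: simple_graph_def delete_vertex_def)
  have "joined H x y" if xy: "x \<in> verts H" "y \<in> verts H" for x y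
  proof -
    have "x \<in> verts G - {c}" "y \<in> verts G - {c}" "c \<in> verts G"
      using xy c_new(1) by (auto simp: verts_G)
    then have "joined ?D x y"
      using assms by (auto simp: cut_vertex_def connected_graph_def)
    then have "(x, y) \<in> (adj {e \<in> edges G. c \<notin> e})\<^sup>*"
      by (simp add: joined_iff[OF D]) (simp add: delete_vertex_def)
    then obtain m where m: "(x, y) \<in> adj {e \<in> edges G. c \<notin> e} ^^ m"
      by (meson rtrancl_imp_relpow)
    then have walk: "(x, y) \<in> adj {e \<in> edges G. e \<inter> insert c (s ` ({} \<inter> T)) = {}} ^^ m"
      by simp
    obtain m' where "(x, y) \<in> adj (edges H - {} \<inter> T) ^^ m'"
      using walk_contract[OF xy walk] .
    then show ?thesis
      using xy relpow_imp_rtrancl[of "(x, y)"] by (simp add: joined_iff[OF simple_H])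
  qed
  moreover have "verts H \<noteq> {}"
  proof -
    obtain e where "e \<in> T"
      using card_T by fastforce
    then have "e \<noteq> {}" "e \<subseteq> verts H"
      using T_edges(2,3)[of e] by auto
    then show ?thesis by blast
  qed
  ultimately show ?thesis
    by (auto simp: connected_graph_def)
qed

section \<open>Girth and the tripod operation\<close>

text \<open>Three kinds of cycles. One through c runs between two different triple edges and is long
  by their distance. One through some \<open>s e\<close> but not c becomes, with its two half edges
  replaced by e, a closed detour of H around e that is shorter by at least one. One through no new
  vertex is a cycle of H missing the triple, so eligibility excludes length k - 1.\<close>

lemma girth_G:
  assumes k: "5 \<le> k" and H: "enat (k - 1) \<le> girth H" and el: "eligible k H T"
  shows "enat k \<le> girth G"
  unfolding girth_ge_iff
proof (intro allI impI)
  fix z assume z: "is_cycle G z"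
  have dist: "k \<le> m + 4"
    if "e \<in> T" "e' \<in> T" "e \<noteq> e'" "x \<in> e" "y \<in> e'" "(x, y) \<in> adj (edges H) ^^ m" for e e' x y m
  proof (rule edge_dist_le_walk[OF simple_H _ _ that(3) k _ that(4-6)])
    show "enat (k - 2) \<le> edge_dist H e e'"
      using el min_triple_dist_ge_iff[OF card_T] that by (auto simp: eligible_def)
  qed (use that T_edges in auto)
  consider "c \<in> set z" | e where "c \<notin> set z" "e \<in> T" "s e \<in> set z"
    | "c \<notin> set z" "s ` T \<inter> set z = {}"
    by blast
  then show "k \<le> length z"
  proof cases
    case 1
    then obtain p where p: "is_cycle G (c # p)" "length (c # p) = length z"
      using cycle_vertex_first[OF z] by metis
    note p' = is_cycle_ConsD[OF p(1)]
    obtain e e' where e: "e \<in> T" "hd p = s e" "e' \<in> T" "last p = s e'"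
      using p'(6,7) by (auto simp: edge_centre_iff)
    have "e \<noteq> e'"
      using e p'(8) by auto
    let ?E = "{e \<in> edges G. e \<inter> insert c (s ` ({} \<inter> T)) = {}}"
    have "walk_edges p \<subseteq> ?E"
      using p'(4,5) in_walk_edges_subset by fastforce
    then have walk: "(s e, s e') \<in> adj ?E ^^ (length p - 1)"
      using walk_edges_relpow[of p ?E] p'(2) e by simp
    obtain m where m: "length p - 1 = Suc m"
      using p'(1) by (cases "length p - 1") auto
    obtain x where x: "(s e, x) \<in> adj ?E" "(x, s e') \<in> adj ?E ^^ m"
      using walk unfolding m by (rule relpow_Suc_E2)
    then have "x \<in> e"
      using edge_subdiv_iff[OF e(1)] by auto
    have "x \<noteq> s e'"
      using \<open>x \<in> e\<close> e s_new T_edges(2) by blast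
    then obtain m2 where "m = Suc m2"
      using x(2) by (cases m) auto
    moreover obtain y where "(x, y) \<in> adj ?E ^^ m2" "(y, s e') \<in> adj ?E"
      using x(2) unfolding \<open>m = Suc m2\<close> by (rule relpow_Suc_E)
    ultimately have m2: "m = Suc m2" "(x, y) \<in> adj ?E ^^ m2" "(y, s e') \<in> adj ?E"
      by blast+
    then have "y \<in> e'"
      using edge_subdiv_iff[OF e(3)] by (auto simp: insert_commute)
    then have xy: "x \<in> verts H" "y \<in> verts H"
      using \<open>x \<in> e\<close> e T_edges(2) by blast+
    obtain m' where "m' \<le> m2" "(x, y) \<in> adj (edges H - {} \<inter> T) ^^ m'"
      using walk_contract[OF xy m2(2)] .
    \<comment> \<open>The cycle has m2 + 4 edges: besides the walk from x to y, the two edges at c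
      and one half of each of e and e'.\<close>
    then have "k \<le> m' + 4"
      using dist[OF e(1,3) \<open>e \<noteq> e'\<close> \<open>x \<in> e\<close> \<open>y \<in> e'\<close>] by simp
    then show ?thesis
      using \<open>m' \<le> m2\<close> m m2(1) p(2) by simp
  next
    case 2
    then obtain p where p: "is_cycle G (s e # p)" "length (s e # p) = length z" "set (s e # p) = set z"
      using cycle_vertex_first[OF z] by metis
    note p' = is_cycle_ConsD[OF p(1)]
    have "c \<notin> set p"
      using p(3) 2(1) by auto
    have "hd p \<noteq> c" "last p \<noteq> c"
      using \<open>c \<notin> set p\<close> p'(2) by (auto dest: hd_in_set last_in_set)
    then have "hd p \<in> e" "last p \<in> e"
      using p'(6,7) edge_subdiv_iff[OF 2(2)] by auto
    then have e: "e = {hd p, last p}"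
      using T_edges(3)[OF 2(2)] p'(8) by (auto simp: card_2_iff)
    let ?E = "{f \<in> edges G. f \<inter> insert c (s ` ({e} \<inter> T)) = {}}"
    have "walk_edges p \<subseteq> ?E"
      using p'(4,5) \<open>c \<notin> set p\<close> in_walk_edges_subset by fastforce
    then have walk: "(hd p, last p) \<in> adj ?E ^^ (length p - 1)"
      using walk_edges_relpow[of p ?E] p'(2) by simp
    have "hd p \<in> verts H" "last p \<in> verts H"
      using \<open>hd p \<in> e\<close> \<open>last p \<in> e\<close> T_edges(2)[OF 2(2)] by blast+
    then obtain m' where m': "m' \<le> length p - 1" "(hd p, last p) \<in> adj (edges H - {e} \<inter> T) ^^ m'"
      using walk_contract[OF _ _ walk] by metis
    moreover have "{e} \<inter> T = {{hd p, last p}}"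
      using 2(2) e by auto
    ultimately obtain q where "is_cycle H q" "length q \<le> Suc m'"
      using cycle_through_edge[OF simple_H, of "hd p" "last p" m'] T_edges(1)[OF 2(2)] e by metis
    \<comment> \<open>Closing by e costs one edge where z spends two, which makes up for the girth
      of H being only k - 1.\<close>
    then have "k - 1 \<le> Suc m'"
      using H by (force simp: girth_ge_iff)
    then show ?thesis
      using m'(1) p(2) p'(1) by simp
  next
    case 3
    have zH: "set z \<subseteq> verts H"
      using z 3 unfolding is_cycle_def verts_G by blast
    have "z \<noteq> []"
      using z by (auto simp: is_cycle_def)
    then have "e \<subseteq> set z" if "e \<in> cycle_edges z" for e
      using that in_walk_edges_subset[of e "z @ [hd z]"] by (auto simp: cycle_edges_def)
    moreover have "e \<in> edges H - T" if "e \<in> edges G" "e \<subseteq> verts H" for e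
      using that edge_old_iff simple_graphD(3)[OF simple_G that(1)] by (auto simp: card_2_iff)
    ultimately have "cycle_edges z \<subseteq> edges H - T"
      using z zH unfolding is_cycle_def by blast
    then have "is_cycle H z" "cycle_edges z \<inter> T = {}"
      using z zH by (auto simp: is_cycle_def)
    then have "k - 1 \<le> length z" "length z \<noteq> k - 1"
      using H el by (auto simp: girth_ge_iff eligible_def)
    then show ?thesis by simp
  qed
qed

text \<open>A walk free of triple edges survives in G, and c closes it to a cycle of length at most
  m + 4. Any other walk is cut at a triple edge, and one of the pieces is a shorter walk between two
  different triple edges.\<close>

lemma triple_walk_length:
  assumes G: "enat k \<le> girth G"
    and "e \<in> T" "e' \<in> T" "e \<noteq> e'" "x \<in> e" "y \<in> e'" "(x, y) \<in> adj (edges H) ^^ m"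
  shows "k \<le> m + 4"
  using assms(2-)
proof (induction m arbitrary: e e' x y rule: less_induct)
  case (less m)
  from adj_relpow_split[OF less.prems(6), of T] show ?case
  proof (elim disjE exE conjE)
    fix a b i j
    assume ab: "{a, b} \<in> edges H \<inter> T" "(x, a) \<in> adj (edges H) ^^ i"
      "(b, y) \<in> adj (edges H) ^^ j" "Suc (i + j) = m"
    show ?thesis
    \<comment> \<open>If the walk traverses e itself, the remainder still leads from e to e';
      otherwise the initial part already joins e to a different triple edge.\<close>
    proof (cases "e = {a, b}")
      case True
      then have "k \<le> j + 4"
        using less.IH[of j e e' b y] less.prems ab by auto
      then show ?thesis
        using ab(4) by simp
    next
      case False
      then have "k \<le> i + 4"
        using less.IH[of i e "{a, b}" x a] less.prems ab by auto
      then show ?thesis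
        using ab(4) by simp
    qed
  next
    assume walk: "(x, y) \<in> adj (edges H - T) ^^ m"
    define E where "E = {e \<in> edges G. c \<notin> e}"
    have "edges H - T \<subseteq> E"
      using old_edges_subset by (auto simp: E_def)
    then have "(x, y) \<in> adj E ^^ m"
      using walk by (rule adj_relpow_mono)
    moreover have "x \<noteq> c" "y \<noteq> c"
      using less.prems T_edges(2) c_new(1) by blast+
    then have "(s e, x) \<in> adj E" "(y, s e') \<in> adj E"
      using edge_subdiv_iff[of e x] edge_subdiv_iff[of e' y] less.prems c_new(2)
      by (auto simp: E_def insert_commute)
    ultimately have walk: "(s e, s e') \<in> adj E ^^ Suc (Suc m)"
      by (blast intro: relpow_Suc_I relpow_Suc_I2)
    have ends: "{c, s e} \<in> edges G" "{c, s e'} \<in> edges G" "s e \<noteq> s e'"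
      using less.prems(1-3) s_eq_iff edge_centre_iff by auto
    obtain z where "is_cycle G z" "length z \<le> Suc (Suc m) + 2"
      using cycle_through_vertex[OF simple_G ends walk[unfolded E_def]] .
    then show ?thesis
      using G by (force simp: girth_ge_iff)
  qed
qed

text \<open>A cycle missing the triple is a cycle of G. With exactly one triple edge e, the detour
  through \<open>s e\<close> makes it a cycle of G with one more edge, whence the loss of one in the
  bound. With at least two, it is cut at two of them and both arcs are long.\<close>

lemma cycle_lengths_H:
  assumes k: "5 \<le> k" and G: "enat k \<le> girth G" and z: "is_cycle H z"
  shows "k - 1 \<le> length z" "cycle_edges z \<inter> T = {} \<Longrightarrow> k \<le> length z"
proof -
  show *: "k \<le> length z" if "cycle_edges z \<inter> T = {}"
  proof -
    have "edges H - T \<subseteq> edges G"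
      using edges_G by blast
    moreover have "cycle_edges z \<subseteq> edges H - T" "set z \<subseteq> verts G"
      using z that by (auto simp: is_cycle_def verts_G)
    ultimately have "is_cycle G z"
      using z by (simp add: is_cycle_def)
    then show ?thesis
      using G by (simp add: girth_ge_iff)
  qed
  show "k - 1 \<le> length z"
  proof (cases "cycle_edges z \<inter> T = {}")
    case True
    then show ?thesis
      using * by simp
  next
    case False
    then obtain e where e: "e \<in> cycle_edges z" "e \<in> T"
      by blast
    obtain p where p: "is_cycle H p" "length p = length z" "cycle_edges p = cycle_edges z"
      "e = {hd p, last p}" "e \<notin> walk_edges p"
      using z e(1) by (rule cycle_edge_last)
    have p': "p \<noteq> []" "3 \<le> length p"
      using p(1) by (auto simp: is_cycle_def)
    have "walk_edges p \<subseteq> edges H - {e}"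
      using p(1,5) p'(1) by (auto simp: is_cycle_def cycle_edges_conv)
    then have walk: "(hd p, last p) \<in> adj (edges H - {e}) ^^ (length p - 1)"
      using p'(1) by (rule walk_edges_relpow)
    from adj_relpow_split[OF walk, of T] show ?thesis
    proof (elim disjE exE conjE)
      assume walk: "(hd p, last p) \<in> adj (edges H - {e} - T) ^^ (length p - 1)"
      define E where "E = {f \<in> edges G. s e \<notin> f}"
      have "edges H - {e} - T \<subseteq> E"
        using old_edges_subset e(2) by (auto simp: E_def)
      then have walk: "(hd p, last p) \<in> adj E ^^ (length p - 1)"
        using walk by (rule adj_relpow_mono)
      have ends: "{s e, hd p} \<in> edges G" "{s e, last p} \<in> edges G" "hd p \<noteq> last p"
        using edge_subdiv_iff[OF e(2)] p(4) T_edges(3)[OF e(2)] by auto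
      obtain q where "is_cycle G q" "length q \<le> length p - 1 + 2"
        using cycle_through_vertex[OF simple_G ends walk[unfolded E_def]] .
      then show ?thesis
        using G p(2) p'(2) by (force simp: girth_ge_iff)
    next
      fix a b i j
      assume ab: "{a, b} \<in> (edges H - {e}) \<inter> T" "(hd p, a) \<in> adj (edges H - {e}) ^^ i"
        "(b, last p) \<in> adj (edges H - {e}) ^^ j" "Suc (i + j) = length p - 1"
      have "(hd p, a) \<in> adj (edges H) ^^ i" "(b, last p) \<in> adj (edges H) ^^ j"
        by (rule adj_relpow_mono[OF Diff_subset ab(2)], rule adj_relpow_mono[OF Diff_subset ab(3)])
      moreover have "{a, b} \<in> T" "{a, b} \<noteq> e"
        using ab(1) by auto
      ultimately have "k \<le> i + 4" "k \<le> j + 4"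
        using triple_walk_length[OF G e(2), of "{a, b}" "hd p" a i]
          triple_walk_length[OF G _ e(2), of "{a, b}" b "last p" j] p(4) by auto
      \<comment> \<open>The length is i + j + 2 with i and j at least k - 4, hence at least 2k - 6,
        and this is at least k - 1 because k \<ge> 5.\<close>
      then show ?thesis
        using k ab(4) p(2) p'(2) by linarith
    qed
  qed
qed

lemma girth_H:
  assumes "5 \<le> k" "enat k \<le> girth G"
  shows "enat (k - 1) \<le> girth H"
  using cycle_lengths_H(1)[OF assms] by (auto simp: girth_ge_iff)

text \<open>The distance condition is the walk inequality read backwards, and a cycle of H avoiding
  the triple has length at least k, so one of length k - 1 must meet it.\<close>

lemma eligible_triple:
  assumes "5 \<le> k" "enat k \<le> girth G"
  shows "eligible k H T"
  unfolding eligible_def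
proof (intro conjI allI impI)
  show "enat (k - 2) \<le> min_triple_dist H T"
    unfolding min_triple_dist_ge_iff[OF card_T]
  proof (intro ballI impI)
    fix e e' assume e: "e \<in> T" "e' \<in> T" "e \<noteq> e'"
    from e(3) show "enat (k - 2) \<le> edge_dist H e e'"
      by (rule edge_dist_geI) (rule triple_walk_length[OF assms(2) e])
  qed
  show "cycle_edges z \<inter> T \<noteq> {}" if "is_cycle H z \<and> length z = k - 1" for z
    using cycle_lengths_H(2)[OF assms, of z] that assms(1) by auto
qed (rule triple)

text \<open>Every short cycle uses an edge of the triple, and disjoint cycles use different ones.\<close>

lemma disjoint_short_cycles_H:
  assumes "5 \<le> k" "enat k \<le> girth G"
  shows "at_most_disjoint_cycles H 3 (k - 1)"
  unfolding at_most_disjoint_cycles_def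
proof (intro allI impI, elim conjE)
  fix C assume C: "\<forall>z\<in>C. is_cycle H z \<and> length z = k - 1" "pairwise (\<lambda>z z'. set z \<inter> set z' = {}) C"
  have "\<exists>e. e \<in> T \<and> e \<in> cycle_edges z" if "z \<in> C" for z
    using eligible_triple[OF assms] C(1) that by (auto simp: eligible_def)
  then obtain f where f: "\<And>z. z \<in> C \<Longrightarrow> f z \<in> T \<and> f z \<in> cycle_edges z"
    by metis
  have fz: "f z \<noteq> {}" "f z \<subseteq> set z" if "z \<in> C" for z
  proof -
    show "f z \<noteq> {}"
      using T_edges(3)[of "f z"] f[OF that] by auto
    have "z \<noteq> []"
      using C(1) that by (auto simp: is_cycle_def)
    then show "f z \<subseteq> set z"
      using in_walk_edges_subset[of "f z" "z @ [hd z]"] f[OF that] by (auto simp: cycle_edges_def)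
  qed
  have "inj_on f C"
  proof (rule inj_onI, rule ccontr)
    fix z z' assume z: "z \<in> C" "z' \<in> C" "f z = f z'" "z \<noteq> z'"
    then have "set z \<inter> set z' = {}"
      using C(2) by (simp add: pairwise_def)
    then show False
      using fz[OF z(1)] fz[OF z(2)] z(3) by blast
  qed
  moreover have "f ` C \<subseteq> T"
    using f by blast
  ultimately show "finite C \<and> card C \<le> 3"
    using finite_T card_T card_inj_on_le[of f C T] inj_on_finite[of f C T] by auto
qed

end

section \<open>Invariance under isomorphism\<close>

lemma relabel_comp: "relabel g (relabel f G) = relabel (g \<circ> f) G"
  by (simp add: relabel_def image_comp comp_def)

lemma relabel_cong:
  assumes "simple_graph G" "\<And>x. x \<in> verts G \<Longrightarrow> f x = g x"
  shows "relabel f G = relabel g G"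
proof -
  have "f ` e = g ` e" if "e \<in> edges G" for e
    using simple_graphD(2)[OF assms(1) that] assms(2) by (auto intro!: image_cong)
  then show ?thesis
    using assms(2) by (simp add: relabel_def)
qed

lemma relabel_id: "simple_graph G \<Longrightarrow> (\<And>x. x \<in> verts G \<Longrightarrow> f x = x) \<Longrightarrow> relabel f G = G"
  using relabel_cong[of G f id] by (simp add: relabel_def)

lemma graph_iso_verts: "graph_iso f G H \<Longrightarrow> v \<in> verts G \<Longrightarrow> f v \<in> verts H"
  by (auto simp: graph_iso_def relabel_def)

lemma graph_iso_comp:
  assumes "graph_iso f G H" "graph_iso g H K"
  shows "graph_iso (g \<circ> f) G K"
  using assms by (auto simp: graph_iso_def relabel_comp[symmetric] intro!: comp_inj_on)
    (simp add: relabel_def)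

lemma simple_graph_relabel:
  assumes "simple_graph G" "inj_on f (verts G)"
  shows "simple_graph (relabel f G)"
proof -
  have "card (f ` e) = 2" if "e \<in> edges G" for e
    using simple_graphD(2,3)[OF assms(1) that] assms(2)
    by (metis card_image inj_on_subset)
  then show ?thesis
    using assms(1) by (auto simp: simple_graph_def relabel_def)
qed

lemma graph_iso_simple: "graph_iso f G H \<Longrightarrow> simple_graph G \<Longrightarrow> simple_graph H"
  using simple_graph_relabel by (auto simp: graph_iso_def)

lemma graph_iso_inverse:
  assumes "graph_iso f G H" "simple_graph G"
  obtains g where "graph_iso g H G" "\<And>x. x \<in> verts G \<Longrightarrow> g (f x) = x"
proof
  let ?g = "inv_into (verts G) f"
  have f: "inj_on f (verts G)" "H = relabel f G"
    using assms(1) by (auto simp: graph_iso_def)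
  show *: "?g (f x) = x" if "x \<in> verts G" for x
    using f(1) that by simp
  have "relabel ?g H = G"
    unfolding f(2) relabel_comp using * by (intro relabel_id[OF assms(2)]) simp
  moreover have "inj_on ?g (verts H)"
    using f by (simp add: relabel_def inj_on_inv_into)
  ultimately show "graph_iso ?g H G"
    by (simp add: graph_iso_def)
qed

lemma isomorphic_sym: "isomorphic G H \<Longrightarrow> simple_graph G \<Longrightarrow> isomorphic H G"
  by (metis graph_iso_inverse isomorphic_def)

lemma isomorphic_trans: "isomorphic G H \<Longrightarrow> isomorphic H K \<Longrightarrow> isomorphic G K"
  by (metis graph_iso_comp isomorphic_def)

text \<open>Extending an isomorphism to a permutation of the whole vertex type removes all side
  conditions from the invariance statements below.\<close>

lemma inj_on_extend_bij:
  fixes f :: "'a \<Rightarrow> 'a"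
  assumes "finite A" "inj_on f A"
  obtains h where "bij h" "\<And>x. x \<in> A \<Longrightarrow> h x = f x"
proof -
  let ?U = "A \<union> f ` A"
  \<comment> \<open>A and its image have equally many elements, so their complements in the finite
    union can be matched; everything outside the union stays fixed.\<close>
  have "card (?U - A) = card (?U - f ` A)"
    using assms by (simp add: card_Diff_subset card_image)
  then obtain g where g: "bij_betw g (?U - A) (?U - f ` A)"
    using assms(1) by (meson finite_same_card_bij finite_Diff finite_UnI finite_imageI)
  define h where "h x = (if x \<in> A then f x else if x \<in> ?U then g x else x)" for x
  have "bij_betw h A (f ` A)"
    using assms(2) by (simp add: h_def bij_betw_def inj_on_def)
  moreover have "bij_betw h (?U - A) (?U - f ` A)"
    using g by (subst bij_betw_cong[of _ _ g]) (auto simp: h_def)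
  ultimately have "bij_betw h (A \<union> (?U - A)) (f ` A \<union> (?U - f ` A))"
    by (rule bij_betw_combine) auto
  moreover have "A \<union> (?U - A) = ?U" "f ` A \<union> (?U - f ` A) = ?U"
    by auto
  ultimately have "bij_betw h ?U ?U"
    by simp
  moreover have "bij_betw h (- ?U) (- ?U)"
    by (subst bij_betw_cong[of _ _ id]) (auto simp: h_def)
  ultimately have "bij_betw h (?U \<union> - ?U) (?U \<union> - ?U)"
    by (rule bij_betw_combine) auto
  moreover have "?U \<union> - ?U = UNIV"
    by blast
  ultimately have "bij h"
    by argo
  then show thesis
    by (rule that) (simp add: h_def)
qed

lemma graph_iso_extend_bij:
  fixes f :: "'v \<Rightarrow> 'v"
  assumes "graph_iso f G H" "simple_graph G"
  obtains h where "bij h" "\<And>x. x \<in> verts G \<Longrightarrow> h x = f x" "relabel h G = H"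
proof -
  obtain h where "bij h" "\<And>x. x \<in> verts G \<Longrightarrow> h x = f x"
    using assms simple_graphD(1)[OF assms(2)] inj_on_extend_bij by (metis graph_iso_def)
  then show thesis
    using that assms relabel_cong[OF assms(2), of h f] by (auto simp: graph_iso_def)
qed

section \<open>Transport of the graph notions along a permutation of the vertex type\<close>

locale relabelling =
  fixes h :: "'v \<Rightarrow> 'v"
  assumes bij: "bij h"
begin

lemma h_eq_iff [simp]: "h x = h y \<longleftrightarrow> x = y"
  using bij by (simp add: bij_is_inj inj_eq)

lemma inj_h: "inj_on h A"
  by (simp add: inj_on_def)

lemma image_eq_iff [simp]: "h ` A = h ` B \<longleftrightarrow> A = B"
  using bij by (simp add: bij_is_inj inj_image_eq_iff)

lemma surj_map: obtains q where "p = map h q"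
proof
  show "p = map h (map (inv h) p)"
    using bij by (simp add: comp_def bij_is_surj surj_f_inv_f)
qed

lemma graph_iso_relabel: "graph_iso h G (relabel h G)"
  using inj_h by (simp add: graph_iso_def)

lemma verts_relabel [simp]: "verts (relabel h G) = h ` verts G"
  by (simp add: relabel_def)

lemma edges_relabel: "edges (relabel h G) = (`) h ` edges G"
  by (simp add: relabel_def)

lemma in_verts_relabel [simp]: "h x \<in> h ` A \<longleftrightarrow> x \<in> A"
  by auto

lemma in_image_image [simp]: "h ` e \<in> (`) h ` E \<longleftrightarrow> e \<in> E"
  by auto

lemma pair_relabel [simp]: "{h x, h y} \<in> edges (relabel h G) \<longleftrightarrow> {x, y} \<in> edges G"
  using in_image_image[of "{x, y}" "edges G"] by (simp add: edges_relabel)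

lemma simple_relabel: "simple_graph G \<Longrightarrow> simple_graph (relabel h G)"
  by (rule simple_graph_relabel[OF _ inj_h])

lemma nbrs_relabel [simp]: "nbrs (relabel h G) (h v) = h ` nbrs G v"
proof (intro equalityI subsetI)
  fix x assume x: "x \<in> nbrs (relabel h G) (h v)"
  have "x = h (inv h x)"
    using bij by (simp add: bij_is_surj surj_f_inv_f)
  with x have "h (inv h x) \<in> nbrs (relabel h G) (h v)"
    by simp
  then have "inv h x \<in> nbrs G v"
    by (simp add: nbrs_def)
  then show "x \<in> h ` nbrs G v"
    using \<open>x = h (inv h x)\<close> by blast
qed (auto simp: nbrs_def)

lemma walk_edges_map [simp]: "walk_edges (map h p) = (`) h ` walk_edges p"
proof (induction p)
  case (Cons a p)
  then show ?case by (cases p) auto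
qed simp

lemma cycle_edges_map [simp]: "cycle_edges (map h z) = (`) h ` cycle_edges z"
proof (cases z)
  case (Cons a p)
  then show ?thesis
    using walk_edges_map[of "a # p @ [a]"] by (simp add: cycle_edges_def del: walk_edges_map)
qed (simp add: cycle_edges_def)

lemma image_image_subset_iff [simp]: "(`) h ` E \<subseteq> (`) h ` F \<longleftrightarrow> E \<subseteq> F"
  by (rule inj_image_subset_iff) (simp add: inj_def)

lemma image_subset_image_iff [simp]: "h ` A \<subseteq> h ` B \<longleftrightarrow> A \<subseteq> B"
  by auto

lemma is_path_map [simp]: "is_path (relabel h G) (map h p) \<longleftrightarrow> is_path G p"
  by (simp add: is_path_def edges_relabel distinct_map inj_h)

lemma is_cycle_map [simp]: "is_cycle (relabel h G) (map h z) \<longleftrightarrow> is_cycle G z"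
  by (simp add: is_cycle_def edges_relabel distinct_map inj_h)

text \<open>Since h permutes the whole type, every list has the form \<open>map h q\<close>.
  Quantified paths and cycles can thus be reindexed, after which the rules for \<open>map h\<close>
  apply.\<close>

lemma all_list_iff: "(\<forall>p. P p) \<longleftrightarrow> (\<forall>p. P (map h p))"
proof (intro iffI allI)
  fix p assume "\<forall>p. P (map h p)"
  moreover obtain q where "p = map h q"
    by (rule surj_map)
  ultimately show "P p"
    by simp
qed simp

lemma ex_list_iff: "(\<exists>p. P p) \<longleftrightarrow> (\<exists>p. P (map h p))"
  using all_list_iff[of "\<lambda>p. \<not> P p"] by blast

lemma Collect_list_eq: "{p. P p} = map h ` {p. P (map h p)}"
proof (intro equalityI subsetI)
  fix p assume p: "p \<in> {p. P p}"
  obtain q where "p = map h q"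
    by (rule surj_map)
  with p show "p \<in> map h ` {p. P (map h p)}"
    by simp
qed auto

lemma paths_relabel:
  "{p. is_path (relabel h G) p \<and> hd p = h u \<and> last p = h v} =
    map h ` {p. is_path G p \<and> hd p = u \<and> last p = v}"
proof -
  have *: "is_path (relabel h G) (map h p) \<and> hd (map h p) = h u \<and> last (map h p) = h v \<longleftrightarrow>
    is_path G p \<and> hd p = u \<and> last p = v" for p
  \<comment> \<open>\<open>hd\<close> and \<open>last\<close> of the empty list do not commute with
    \<open>map h\<close>; that list is excluded on both sides because it is no path.\<close>
  proof (cases "p = []")
    case False
    then show ?thesis
      by (simp add: hd_map last_map)
  qed (simp add: is_path_def)
  show ?thesis
    by (subst Collect_list_eq) (simp only: *)
qed

lemma joined_relabel [simp]: "joined (relabel h G) (h u) (h v) \<longleftrightarrow> joined G u v"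
proof -
  have *: "joined G u v \<longleftrightarrow> {p. is_path G p \<and> hd p = u \<and> last p = v} \<noteq> {}" for G :: "'v graph" and u v
    by (auto simp: joined_def)
  show ?thesis
    unfolding * paths_relabel by simp
qed

lemma gdist_relabel [simp]: "gdist (relabel h G) (h u) (h v) = gdist G u v"
  by (simp add: gdist_def paths_relabel image_comp comp_def)

lemma edge_dist_relabel [simp]: "edge_dist (relabel h G) (h ` e) (h ` e') = edge_dist G e e'"
  unfolding edge_dist_def by (subst Collect_list_eq) (simp add: image_comp comp_def)

lemma eligible_relabel:
  assumes "eligible k G T"
  shows "eligible k (relabel h G) ((`) h ` T)"
proof -
  have T: "T \<subseteq> edges G" "card T = 3"
    using assms by (auto simp: eligible_def edge_triple_def)
  have card: "card ((`) h ` T) = 3"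
    using T(2) by (simp add: card_image inj_on_def)
  have "(`) h ` A \<inter> (`) h ` T = (`) h ` (A \<inter> T)" for A
    by auto
  moreover have "\<forall>e\<in>T. \<forall>e'\<in>T. e \<noteq> e' \<longrightarrow> enat (k - 2) \<le> edge_dist G e e'"
    using assms min_triple_dist_ge_iff[OF T(2)] by (simp add: eligible_def)
  then have "enat (k - 2) \<le> min_triple_dist (relabel h G) ((`) h ` T)"
    unfolding min_triple_dist_ge_iff[OF card] by simp
  ultimately show ?thesis
    unfolding eligible_def using assms card
    by (subst all_list_iff) (simp add: eligible_def edge_triple_def edges_relabel)
qed

lemma delete_vertex_relabel: "delete_vertex (relabel h G) (h v) = relabel h (delete_vertex G v)"
  by (auto simp: delete_vertex_def relabel_def image_set_diff[OF inj_h])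

lemma cut_vertex_relabel [simp]: "cut_vertex (relabel h G) (h v) \<longleftrightarrow> cut_vertex G v"
proof -
  have "h ` verts G - {h v} = h ` (verts G - {v})"
    by auto
  then show ?thesis
    by (simp add: cut_vertex_def delete_vertex_relabel)
qed

lemma reducible_relabel [simp]: "reducible_tripod (relabel h G) (h v) \<longleftrightarrow> reducible_tripod G v"
proof -
  have "card (set (map h z) \<inter> h ` nbrs G v) = card (set z \<inter> nbrs G v)" for z
    using card_image[OF inj_h, of "set z \<inter> nbrs G v"] by (simp add: image_Int[OF inj_h])
  then show ?thesis
    unfolding reducible_tripod_def by (subst all_list_iff) simp
qed

lemma nbrs_in_cycle_avoiding_relabel [simp]:
  "nbrs_in_cycle_avoiding (relabel h G) l (h v) = nbrs_in_cycle_avoiding G l v"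
proof -
  have *: "(\<exists>z. is_cycle (relabel h G) z \<and> length z = l \<and> h w \<in> set z \<and> h v \<notin> set z) \<longleftrightarrow>
    (\<exists>z. is_cycle G z \<and> length z = l \<and> w \<in> set z \<and> v \<notin> set z)" for w
    by (subst ex_list_iff) simp
  have "{w \<in> h ` N. P w} = h ` {w \<in> N. P (h w)}" for N P
    by blast
  then show ?thesis
    by (simp add: nbrs_in_cycle_avoiding_def * card_image[OF inj_h])
qed

lemma within_dist_relabel [simp]: "within_dist (relabel h G) d (h v) = within_dist G d v"
proof -
  have "{w \<in> h ` N. P w} = h ` {w \<in> N. P (h w)}" for N P
    by blast
  then show ?thesis
    by (simp add: within_dist_def card_image[OF inj_h])
qed

end

section \<open>Canonical labels and vertex orbits\<close>

text \<open>Both graphs have the same canonically labelled graph. Going from G to H, through an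
  automorphism of H, to the labels and back by the inverse of \<open>canon G\<close> is an
  automorphism of G, and it sends v to the vertex of G carrying the given label.\<close>

lemma canonical_orbit_subset:
  assumes canon: "canonical_labelling canon" and G: "simple_graph G" and f: "graph_iso f G H"
    and v: "v \<in> verts G"
  shows "canon H ` vertex_orbit H (f v) \<subseteq> canon G ` vertex_orbit G v"
proof
  fix l assume "l \<in> canon H ` vertex_orbit H (f v)"
  then obtain a where a: "graph_iso a H H" "l = canon H (a (f v))"
    by (auto simp: vertex_orbit_def)
  have H: "simple_graph H"
    using f G by (rule graph_iso_simple)
  have "inj_on (canon K) (verts K)" if "simple_graph K" for K
    using canon that by (auto simp: canonical_labelling_def bij_betw_def)
  moreover have "relabel (canon G) G = relabel (canon H) H"
    using canon G H f unfolding canonical_labelling_def isomorphic_def by blast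
  ultimately have iso: "graph_iso (canon H) H (relabel (canon G) G)" "graph_iso (canon G) G (relabel (canon G) G)"
    using G H by (simp_all add: graph_iso_def)
  obtain g where g: "graph_iso g (relabel (canon G) G) G" "\<And>x. x \<in> verts G \<Longrightarrow> g (canon G x) = x"
    using iso(2) G by (rule graph_iso_inverse) blast
  let ?b = "g \<circ> (canon H \<circ> (a \<circ> f))"
  have fa: "graph_iso (canon H \<circ> (a \<circ> f)) G (relabel (canon G) G)"
    using graph_iso_comp[OF graph_iso_comp[OF f a(1)] iso(1)] .
  then have "graph_iso ?b G G"
    using g(1) by (rule graph_iso_comp)
  then have "?b v \<in> vertex_orbit G v"
    unfolding vertex_orbit_def by blast
  moreover have "canon G (?b v) = l"
  proof -
    have "verts (relabel (canon G) G) = (canon H \<circ> (a \<circ> f)) ` verts G"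
      using fa by (auto simp: graph_iso_def relabel_def)
    \<comment> \<open>The inverse g is known to undo \<open>canon G\<close> only on vertices of G,
      so l has to be recognised as the label of one.\<close>
    then have "l \<in> canon G ` verts G"
      using v a(2) unfolding relabel_def by auto
    then show ?thesis
      using a(2) g(2) by auto
  qed
  ultimately show "l \<in> canon G ` vertex_orbit G v"
    by blast
qed

lemma min_orbit_label_iso:
  assumes canon: "canonical_labelling canon" and G: "simple_graph G" and f: "graph_iso f G H"
    and v: "v \<in> verts G"
  shows "min_orbit_label canon H (f v) = min_orbit_label canon G v"
proof -
  obtain g where g: "graph_iso g H G" "g (f v) = v"
    using graph_iso_inverse[OF f G] v by metis
  have "f v \<in> verts H"
    using f v by (rule graph_iso_verts)
  then have "canon G ` vertex_orbit G v \<subseteq> canon H ` vertex_orbit H (f v)"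
    using canonical_orbit_subset[OF canon graph_iso_simple[OF f G] g(1)] g(2) by metis
  then show ?thesis
    using canonical_orbit_subset[OF assms] by (auto simp: min_orbit_label_def)
qed

text \<open>Orbits are finite and nonempty, so the minima are attained. Labels are injective on
  vertices; equal minima therefore mean that the two orbits share a vertex.\<close>

lemma min_orbit_label_eqD:
  assumes canon: "canonical_labelling canon" and G: "simple_graph G"
    and v: "v \<in> verts G" and w: "w \<in> verts G"
    and eq: "min_orbit_label canon G v = min_orbit_label canon G w"
  obtains f where "graph_iso f G G" "f v = w"
proof -
  have orbit: "vertex_orbit G x \<subseteq> verts G" "x \<in> vertex_orbit G x" if "x \<in> verts G" for x
  proof -
    show "vertex_orbit G x \<subseteq> verts G"
      using that graph_iso_verts by (auto simp: vertex_orbit_def)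
    have "graph_iso id G G"
      by (simp add: graph_iso_def relabel_def)
    then show "x \<in> vertex_orbit G x"
      unfolding vertex_orbit_def by (intro CollectI exI[of _ id]) simp
  qed
  have "Min (canon G ` vertex_orbit G x) \<in> canon G ` vertex_orbit G x" if "x \<in> verts G" for x
    using orbit[OF that] simple_graphD(1)[OF G] by (intro Min_in) (auto intro: finite_subset)
  then have "\<exists>a\<in>vertex_orbit G v. \<exists>b\<in>vertex_orbit G w. canon G a = canon G b"
    using v w eq unfolding min_orbit_label_def by (metis imageE)
  then obtain f g where fg: "graph_iso f G G" "graph_iso g G G" "canon G (f v) = canon G (g w)"
    by (auto simp: vertex_orbit_def)
  then have "f v \<in> verts G" "g w \<in> verts G"
    using v w graph_iso_verts by metis+
  then have "f v = g w"
    using canon G fg(3) by (auto simp: canonical_labelling_def bij_betw_def inj_on_def)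
  obtain g' where g': "graph_iso g' G G" "g' (g w) = w"
    using graph_iso_inverse[OF fg(2) G] w by metis
  show thesis
    using graph_iso_comp[OF fg(1) g'(1)] \<open>f v = g w\<close> g'(2) by (intro that[of "g' \<circ> f"]) auto
qed

lemma (in relabelling) tripod_value_relabel:
  assumes "canonical_labelling canon" "simple_graph G" "v \<in> verts G"
  shows "tripod_value canon (relabel h G) (h v) = tripod_value canon G v"
  using min_orbit_label_iso[OF assms(1,2) graph_iso_relabel assms(3)] by (simp add: tripod_value_def)

lemma (in relabelling) accepted_relabel:
  assumes "canonical_labelling canon" "simple_graph G" "accepted canon G v"
  shows "accepted canon (relabel h G) (h v)"
proof -
  have v: "v \<in> verts G"
    using assms(3) by (auto simp: accepted_def is_arg_min_def reducible_tripod_def)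
  have False if w: "reducible_tripod (relabel h G) w"
    "tripod_value canon (relabel h G) w < tripod_value canon (relabel h G) (h v)" for w
  proof -
    obtain u where u: "w = h u" "u \<in> verts G"
      using w(1) by (auto simp: reducible_tripod_def)
    then show False
      using w tripod_value_relabel[OF assms(1,2)] v assms(3)
      by (auto simp: accepted_def is_arg_min_def)
  qed
  then show ?thesis
    using assms(3) by (auto simp: accepted_def is_arg_min_def)
qed

section \<open>The tripod reduction\<close>

text \<open>Each endvertex contributes the pair of its neighbours other than c, the edge that
  replaces it. Only G and c enter, not a subdividing map, so the construction commutes with
  relabelling.\<close>

definition reduced_triple :: "'v graph \<Rightarrow> 'v \<Rightarrow> 'v set set" where
  "reduced_triple G c = (\<lambda>w. nbrs G w - {c}) ` nbrs G c"

definition reduct :: "'v graph \<Rightarrow> 'v \<Rightarrow> 'v graph" where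
  "reduct G c = \<lparr>verts = verts G - insert c (nbrs G c),
     edges = {e \<in> edges G. e \<inter> insert c (nbrs G c) = {}} \<union> reduced_triple G c\<rparr>"

lemma (in tripod) reduced_triple_G: "reduced_triple G c = T"
proof -
  have "nbrs G (s e) - {c} = e" if "e \<in> T" for e
    using nbrs_subdiv[OF that] T_edges(2)[OF that] c_new(1) by auto
  then show ?thesis
    by (simp add: reduced_triple_def nbrs_centre image_image)
qed

lemma (in tripod) reduct_G: "reduct G c = H"
proof -
  have "{e \<in> edges G. e \<inter> insert c (s ` T) = {}} = edges H - T"
  proof
    show "edges H - T \<subseteq> {e \<in> edges G. e \<inter> insert c (s ` T) = {}}"
      by (rule old_edges_subset)
  qed (auto simp: edges_G)
  moreover have "verts G - insert c (s ` T) = verts H"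
    using s_new c_new(1) by (auto simp: verts_G)
  moreover have "edges H - T \<union> T = edges H"
    using T_edges(1) by blast
  ultimately show ?thesis
    by (simp add: reduct_def nbrs_centre reduced_triple_G)
qed

lemma no_triangle:
  assumes "simple_graph G" "enat 4 \<le> girth G" "{x, y} \<in> edges G" "{y, z} \<in> edges G" "{x, z} \<in> edges G"
  shows False
proof -
  have "is_cycle G [x, y, z]"
    using assms(3-5) simple_graphD(4-6)[OF assms(1)]
    by (auto simp: is_cycle_def cycle_edges_def insert_commute)
  then show False
    using assms(2) by (fastforce simp: girth_ge_iff)
qed

lemma no_square:
  assumes "simple_graph G" "enat 5 \<le> girth G" "{w, x} \<in> edges G" "{x, y} \<in> edges G"
    "{y, z} \<in> edges G" "{z, w} \<in> edges G" "w \<noteq> y" "x \<noteq> z"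
  shows False
proof -
  have "is_cycle G [w, x, y, z]"
    using assms(3-8) simple_graphD(4-6)[OF assms(1)]
    by (auto simp: is_cycle_def cycle_edges_def insert_commute)
  then show False
    using assms(2) by (fastforce simp: girth_ge_iff)
qed

text \<open>Girth 5 makes the reduction invertible. Without triangles the endvertices are pairwise
  nonadjacent, so the new edges have old ends, and none of them was an edge before. Without squares
  different endvertices give different pairs, so the triple has three members.\<close>

lemma tripod_reduct:
  assumes cubic: "cubic G" and girth: "enat 5 \<le> girth G" and c: "c \<in> verts G"
  obtains s where "tripod (reduct G c) (reduced_triple G c) G c s"
proof -
  have simple: "simple_graph G"
    using cubic by (simp add: cubic_def)
  have "enat 4 \<le> enat 5"
    by simp
  then have triangle: False if "{x, y} \<in> edges G" "{y, z} \<in> edges G" "{x, z} \<in> edges G" for x y z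
    using no_triangle[OF simple _ that] girth order.trans by blast
  define N where "N = nbrs G c"
  define t where "t w = nbrs G w - {c}" for w
  have N: "w \<in> N \<longleftrightarrow> {c, w} \<in> edges G" for w
    by (simp add: N_def nbrs_def)
  have t: "x \<in> t w \<longleftrightarrow> {w, x} \<in> edges G \<and> x \<noteq> c" for w x
    by (simp add: t_def nbrs_def)
  have N_verts: "N \<subseteq> verts G" and c_N: "c \<notin> N"
    using simple_graphD(4)[OF simple, of c c] simple_graphD(6)[OF simple] by (auto simp: N)
  have card_t: "card (t w) = 2" if "w \<in> N" for w
  proof -
    have "w \<in> verts G" "c \<in> nbrs G w"
      using that N_verts N by (auto simp: nbrs_def insert_commute)
    moreover have "card (nbrs G w) = 3"
      using cubic calculation(1) by (simp add: cubic_def)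
    ultimately show ?thesis
      by (simp add: t_def)
  qed
  have t_old: "t w \<subseteq> verts G - insert c N" if "w \<in> N" for w
  proof
    fix x assume x: "x \<in> t w"
    have "x \<notin> N"
      using triangle[of c w x] x that by (auto simp: N t)
    then show "x \<in> verts G - insert c N"
      using x t simple_graphD(6)[OF simple] by auto
  qed
  have inj: "inj_on t N"
  proof (rule inj_onI, rule ccontr)
    fix w w' assume w: "w \<in> N" "w' \<in> N" "t w = t w'" "w \<noteq> w'"
    obtain x where "x \<in> t w"
      using card_t[OF w(1)] by fastforce
    then have x: "{w, x} \<in> edges G" "{w', x} \<in> edges G" "x \<noteq> c"
      using w(3) t[of x w] t[of x w'] by blast+
    then show False
      using no_square[OF simple girth, of c w x w'] w(1,2,4) N by (auto simp: insert_commute)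
  qed
  have t_new: "t w \<notin> edges G" if "w \<in> N" for w
  proof
    assume edge: "t w \<in> edges G"
    have "card (t w) = 2"
      using that by (rule card_t)
    then obtain x y where "t w = {x, y}"
      by (meson card_2_iff)
    then show False
      using triangle[of w x y] edge t[of x w] t[of y w] by auto
  qed
  \<comment> \<open>The subdividing map inverts \<open>t\<close>: the pair \<open>t w\<close> is
    subdivided by the deleted endvertex w itself, which recovers G exactly and not just up to
    isomorphism.\<close>
  let ?T = "t ` N" and ?s = "inv_into N t"
  have T: "reduced_triple G c = ?T"
    by (simp add: reduced_triple_def N_def t_def)
  have H: "verts (reduct G c) = verts G - insert c N"
    "edges (reduct G c) = {e \<in> edges G. e \<inter> insert c N = {}} \<union> ?T"
    by (simp_all add: reduct_def T N_def)
  have s: "?s (t w) = w" if "w \<in> N" for w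
    using inj that by simp
  have "tripod (reduct G c) ?T G c ?s"
  proof
    have "e \<subseteq> verts G - insert c N \<and> card e = 2" if "e \<in> edges (reduct G c)" for e
      using that t_old card_t simple_graphD(2,3)[OF simple, of e] unfolding H by auto
    then show "simple_graph (reduct G c)"
      using simple_graphD(1)[OF simple] by (simp add: simple_graph_def H(1))
    have "card N = 3"
      using cubic c by (simp add: cubic_def N_def)
    then show "edge_triple (reduct G c) ?T"
      using card_image[OF inj] by (simp add: edge_triple_def H(2))
    show "inj_on ?s ?T"
      using s by (auto simp: inj_on_def)
    show "?s e \<notin> verts (reduct G c)" "?s e \<noteq> c" if "e \<in> ?T" for e
      using that s c_N by (auto simp: H(1))
    show "c \<notin> verts (reduct G c)"
      by (simp add: H(1))
    have sT: "?s ` ?T = N"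
      using s by (auto simp: image_image)
    have old: "edges (reduct G c) - ?T = {e \<in> edges G. e \<inter> insert c N = {}}"
      using t_new by (auto simp: H(2))
    have half: "{{u, ?s e} | u e. e \<in> ?T \<and> u \<in> e} = {{u, w} | u w. w \<in> N \<and> u \<in> t w}"
    proof (intro equalityI subsetI)
      fix f assume "f \<in> {{u, ?s e} | u e. e \<in> ?T \<and> u \<in> e}"
      then obtain u w where "f = {u, ?s (t w)}" "w \<in> N" "u \<in> t w"
        by blast
      then show "f \<in> {{u, w} | u w. w \<in> N \<and> u \<in> t w}"
        using s by auto
    next
      fix f assume "f \<in> {{u, w} | u w. w \<in> N \<and> u \<in> t w}"
      then obtain u w where "f = {u, w}" "w \<in> N" "u \<in> t w"
        by blast
      then have "f = {u, ?s (t w)} \<and> t w \<in> ?T \<and> u \<in> t w"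
        using s by simp
      then show "f \<in> {{u, ?s e} | u e. e \<in> ?T \<and> u \<in> e}"
        by blast
    qed
    have centre: "{{c, ?s e} | e. e \<in> ?T} = {{c, w} | w. w \<in> N}"
    proof -
      have "{{c, ?s e} | e. e \<in> ?T} = (\<lambda>w. {c, w}) ` (?s ` ?T)"
        by blast
      then show ?thesis
        unfolding sT by blast
    qed
    have edges: "edges G = {e \<in> edges G. e \<inter> insert c N = {}} \<union> {{u, w} | u w. w \<in> N \<and> u \<in> t w} \<union>
        {{c, w} | w. w \<in> N}"
    proof (intro equalityI subsetI)
      fix e assume e: "e \<in> edges G"
      show "e \<in> {e \<in> edges G. e \<inter> insert c N = {}} \<union> {{u, w} | u w. w \<in> N \<and> u \<in> t w} \<union> {{c, w} | w. w \<in> N}"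
      proof (cases "e \<inter> insert c N = {}")
        case False
        then obtain w where w: "w \<in> e" "w = c \<or> w \<in> N"
          by blast
        then obtain u where u: "e = {w, u}"
          using edge_other_end simple_graphD(3)[OF simple e] by metis
        consider "w = c" | "u = c" | "w \<noteq> c" "u \<noteq> c"
          by blast
        then show ?thesis
        proof cases
          case 1
          then have "u \<in> N"
            using e u by (simp add: N)
          then show ?thesis
            using u 1 by blast
        next
          case 2
          then have "w \<in> N"
            using e u by (simp add: N insert_commute)
          then show ?thesis
            using u 2 by blast
        next
          case 3
          then have "w \<in> N" "u \<in> t w" "e = {u, w}"
            using w e u by (auto simp: t)
          then show ?thesis
            by blast
        qed
      qed (use e in blast)
    next
      fix e assume "e \<in> {e \<in> edges G. e \<inter> insert c N = {}} \<union> {{u, w} | u w. w \<in> N \<and> u \<in> t w} \<union> {{c, w} | w. w \<in> N}"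
      then show "e \<in> edges G"
        by (auto simp: N t insert_commute)
    qed
    have verts: "verts G = (verts G - insert c N) \<union> N \<union> {c}"
      using N_verts c by blast
    show "G = \<lparr>verts = verts (reduct G c) \<union> ?s ` ?T \<union> {c},
      edges = (edges (reduct G c) - ?T) \<union> {{u, ?s e} | u e. e \<in> ?T \<and> u \<in> e} \<union> {{c, ?s e} | e. e \<in> ?T}\<rparr>"
    proof (rule graph.equality)
      show "verts G = verts \<lparr>verts = verts (reduct G c) \<union> ?s ` ?T \<union> {c},
        edges = (edges (reduct G c) - ?T) \<union> {{u, ?s e} | u e. e \<in> ?T \<and> u \<in> e} \<union> {{c, ?s e} | e. e \<in> ?T}\<rparr>"
        unfolding graph.select_convs sT H(1) by (rule verts)
      show "edges G = edges \<lparr>verts = verts (reduct G c) \<union> ?s ` ?T \<union> {c},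
        edges = (edges (reduct G c) - ?T) \<union> {{u, ?s e} | u e. e \<in> ?T \<and> u \<in> e} \<union> {{c, ?s e} | e. e \<in> ?T}\<rparr>"
        unfolding graph.select_convs old half centre by (rule edges)
    qed simp
  qed
  then show thesis
    using that T by simp
qed

text \<open>For girth at least 5 only a pentagon through all three endvertices could violate the cycle
  condition, and there two of them would be adjacent.\<close>

lemma reducible_tripodI:
  assumes cubic: "cubic G" and girth: "enat 5 \<le> girth G" and c: "c \<in> verts G" and cut: "\<not> cut_vertex G c"
  shows "reducible_tripod G c"
  unfolding reducible_tripod_def
proof (intro conjI allI impI c cut)
  fix z assume z: "is_cycle G z"
  have simple: "simple_graph G"
    using cubic by (simp add: cubic_def)
  have card_N: "card (nbrs G c) = 3"
    using cubic c by (simp add: cubic_def)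
  then have "finite (nbrs G c)"
    by (intro card_ge_0_finite) simp
  then have le: "card (set z \<inter> nbrs G c) \<le> 3"
    using card_mono[of "nbrs G c" "set z \<inter> nbrs G c"] card_N by simp
  have len: "5 \<le> length z"
    using girth z by (simp add: girth_ge_iff)
  show "3 + card (set z \<inter> nbrs G c) \<le> length z"
  proof (cases "length z = 5")
    case True
    then obtain a1 a2 a3 a4 a5 where z_eq: "z = [a1, a2, a3, a4, a5]"
      by (auto simp: length_Suc_conv numeral_eq_Suc)
    have indep: "\<not> (x \<in> nbrs G c \<and> y \<in> nbrs G c)" if "{x, y} \<in> edges G" for x y
    proof -
      have "enat 4 \<le> girth G"
        using girth by (auto intro: order.trans[of _ "enat 5"])
      then show ?thesis
        using no_triangle[OF simple, of c x y] that by (auto simp: nbrs_def)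
    qed
    have "{a1, a2} \<in> edges G" "{a2, a3} \<in> edges G" "{a3, a4} \<in> edges G" "{a4, a5} \<in> edges G" "{a5, a1} \<in> edges G"
      using z by (auto simp: z_eq is_cycle_def cycle_edges_def)
    note * = this[THEN indep]
    \<comment> \<open>The cases run through the five pairs of nonadjacent vertices of a pentagon; a
      set without adjacent vertices lies inside one of them.\<close>
    have "\<exists>x y. set z \<inter> nbrs G c \<subseteq> {x, y}"
    proof (cases "a1 \<in> nbrs G c")
      case True
      then have "set z \<inter> nbrs G c \<subseteq> {a1, a3} \<or> set z \<inter> nbrs G c \<subseteq> {a1, a4}"
        using * by (auto simp: z_eq)
      then show ?thesis
        by blast
    next
      case False
      then have "set z \<inter> nbrs G c \<subseteq> {a2, a4} \<or> set z \<inter> nbrs G c \<subseteq> {a2, a5} \<or> set z \<inter> nbrs G c \<subseteq> {a3, a5}"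
        using * by (auto simp: z_eq)
      then show ?thesis
        by blast
    qed
    then obtain x y where "set z \<inter> nbrs G c \<subseteq> {x, y}"
      by blast
    then have "card (set z \<inter> nbrs G c) \<le> card {x, y}"
      by (intro card_mono) auto
    also have "\<dots> \<le> 2"
      by (simp add: card_insert_if)
    finally show ?thesis
      using True by simp
  next
    case False
    then show ?thesis
      using le len by simp
  qed
qed

text \<open>A vertex farthest from a fixed root is never a cut vertex.\<close>

lemma ex_non_cut_vertex:
  assumes G: "simple_graph G" "connected_graph G"
  obtains c where "c \<in> verts G" "\<not> cut_vertex G c"
proof -
  obtain r where r: "r \<in> verts G"
    using G(2) by (auto simp: connected_graph_def)
  define d where "d v = (LEAST m. (r, v) \<in> adj (edges G) ^^ m)" for v
  have d: "(r, v) \<in> adj (edges G) ^^ d v" if "v \<in> verts G" for v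
  proof -
    have "(r, v) \<in> (adj (edges G))\<^sup>*"
      using G r that by (auto simp: connected_graph_def joined_iff)
    then show ?thesis
      unfolding d_def by (auto dest!: rtrancl_imp_relpow intro: LeastI)
  qed
  have d_le: "d v \<le> m" if "(r, v) \<in> adj (edges G) ^^ m" for v m
    unfolding d_def using that by (rule Least_le)
  define M where "M = Max (d ` verts G)"
  have fin: "finite (d ` verts G)" "d ` verts G \<noteq> {}"
    using simple_graphD(1)[OF G(1)] r by auto
  then have "M \<in> d ` verts G"
    unfolding M_def by (rule Max_in)
  then obtain c where c: "c \<in> verts G" "d c = M"
    by auto
  have max: "d v \<le> d c" if "v \<in> verts G" for v
    using fin that c(2) by (simp add: M_def)
  let ?D = "delete_vertex G c"
  have D: "simple_graph ?D"
    using G(1) by (auto simp: simple_graph_def delete_vertex_def)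
  \<comment> \<open>The predecessor of v on a shortest walk from r is closer to r than v, whereas c
    is at maximal distance; so a shortest walk to any other vertex never meets c.\<close>
  have reach: "(r, v) \<in> (adj (edges ?D))\<^sup>*" if "v \<in> verts G - {c}" for v
    using that
  proof (induction "d v" arbitrary: v)
    case 0
    then show ?case
      using d[of v] by simp
  next
    case (Suc m)
    then have "(r, v) \<in> adj (edges G) ^^ Suc m"
      using d[of v] by simp
    then obtain u where u: "(r, u) \<in> adj (edges G) ^^ m" "{u, v} \<in> edges G"
      by auto
    have "u \<in> verts G"
      using u(2) simple_graphD(5)[OF G(1)] by blast
    then have "(r, v) \<in> adj (edges G) ^^ Suc (d u)"
      using u(2) by (intro relpow_Suc_I[OF d]) auto
    then have "m = d u"
      using d_le[OF u(1)] d_le[of v "Suc (d u)"] Suc.hyps(2) by simp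
    moreover have "u \<noteq> c"
      using max[of v] Suc.prems Suc.hyps(2) \<open>m = d u\<close> by auto
    ultimately have "(r, u) \<in> (adj (edges ?D))\<^sup>*"
      using Suc.hyps(1)[of u] \<open>u \<in> verts G\<close> by simp
    moreover have "(u, v) \<in> adj (edges ?D)"
      using u(2) \<open>u \<noteq> c\<close> Suc.prems by (auto simp: delete_vertex_def)
    ultimately show ?case
      by (rule rtrancl_into_rtrancl)
  qed
  have "\<not> cut_vertex G c"
  proof
    assume "cut_vertex G c"
    then obtain u w where uw: "u \<in> verts G - {c}" "w \<in> verts G - {c}" "\<not> joined ?D u w"
      by (auto simp: cut_vertex_def)
    have "sym ((adj (edges ?D))\<^sup>*)"
      using sym_adj by (rule sym_rtrancl)
    then have "(u, w) \<in> (adj (edges ?D))\<^sup>*"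
      using reach uw(1,2) by (meson rtrancl_trans symD)
    then show False
      using uw by (simp add: joined_iff[OF D]) (simp add: delete_vertex_def)
  qed
  with c(1) show thesis
    by (rule that)
qed

section \<open>Isomorphic tripod insertions\<close>

text \<open>Two insertions at the same triple differ only in the names of the new vertices; the
  identity on H extends by matching centres and the vertices subdividing the same edge.\<close>

lemma tripod_unique:
  assumes "tripod H T G c s" "tripod H T G' c' s'"
  obtains f where "graph_iso f G G'" "f c = c'"
proof -
  interpret A: tripod H T G c s by fact
  interpret B: tripod H T G' c' s' by fact
  define f where "f x = (if x \<in> verts H then x else if x = c then c' else s' (inv_into T s x))" for x
  have f_old: "f x = x" if "x \<in> verts H" for x
    using that by (simp add: f_def)
  have f_c: "f c = c'"
    using A.c_new by (simp add: f_def)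
  have f_s: "f (s e) = s' e" if "e \<in> T" for e
    using that A.s_new A.c_new(2) A.inj_s by (simp add: f_def)
  have f_image: "f ` e = e" if "e \<subseteq> verts H" for e
    using that f_old by (force simp: image_iff)
  have "inj_on f (verts G)"
  proof (rule inj_onI)
    fix x y assume "x \<in> verts G" "y \<in> verts G" "f x = f y"
    then show "x = y"
      unfolding A.verts_G using f_old f_c f_s B.s_new B.c_new B.s_eq_iff
      by (elim UnE imageE) (auto dest: sym)
  qed
  moreover have "f ` verts G = verts G'"
    unfolding A.verts_G B.verts_G by (simp add: image_Un f_image f_c image_image f_s)
  moreover have "(`) f ` edges G = edges G'"
  proof -
    have "(`) f ` (edges H - T) = edges H - T"
      using f_image simple_graphD(2)[OF A.simple_H] by (force simp: image_iff)
    moreover have "(`) f ` {{u, s e} | u e. e \<in> T \<and> u \<in> e} = {{u, s' e} | u e. e \<in> T \<and> u \<in> e}"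
    proof -
      have half: "{{u, s e} | u e. e \<in> T \<and> u \<in> e} = (\<Union>e\<in>T. (\<lambda>u. {u, s e}) ` e)" for s :: "'a set \<Rightarrow> 'a"
        by blast
      have "(`) f ` (\<lambda>u. {u, s e}) ` e = (\<lambda>u. {u, s' e}) ` e" if "e \<in> T" for e
        unfolding image_image using f_s[OF that] f_old A.T_edges(2)[OF that]
        by (intro image_cong) auto
      then show ?thesis
        unfolding half image_UN by simp
    qed
    moreover have "(`) f ` {{c, s e} | e. e \<in> T} = {{c', s' e} | e. e \<in> T}"
    proof -
      have centre: "{{c, s e} | e. e \<in> T} = (\<lambda>e. {c, s e}) ` T" for c and s :: "'a set \<Rightarrow> 'a"
        by blast
      show ?thesis
        unfolding centre image_image using f_c f_s by (intro image_cong) auto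
    qed
    ultimately show ?thesis
      unfolding A.edges_G B.edges_G by (simp only: image_Un)
  qed
  ultimately have "graph_iso f G G'"
    by (simp add: graph_iso_def relabel_def)
  then show thesis
    using f_c by (rule that)
qed

context relabelling
begin

text \<open>The subdividing map of the image pulls an edge back along h, subdivides there and pushes
  the new vertex forward.\<close>

lemma tripod_relabel:
  assumes "tripod H T G c s"
  shows "tripod (relabel h H) ((`) h ` T) (relabel h G) (h c) (\<lambda>e. h (s (h -` e)))"
proof -
  interpret tripod H T G c s by fact
  have vimage: "h -` (h ` e) = e" for e
    using inj_h by (simp add: inj_vimage_image_eq)
  show ?thesis
  proof
    show "simple_graph (relabel h H)"
      using simple_H by (rule simple_relabel)
    have "card ((`) h ` T) = card T"
      by (intro card_image) (simp add: inj_on_def)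
    then show "edge_triple (relabel h H) ((`) h ` T)"
      using triple by (simp add: edge_triple_def edges_relabel)
    show "inj_on (\<lambda>e. h (s (h -` e))) ((`) h ` T)"
      using inj_s by (auto simp: inj_on_def vimage)
    show "h (s (h -` e)) \<notin> verts (relabel h H)" "h (s (h -` e)) \<noteq> h c" if e: "e \<in> (`) h ` T" for e
    proof -
      obtain f where "f \<in> T" "e = h ` f"
        using e by blast
      then show "h (s (h -` e)) \<notin> verts (relabel h H)" "h (s (h -` e)) \<noteq> h c"
        using s_new[of f] c_new(2)[of f] by (simp_all add: vimage)
    qed
    show "h c \<notin> verts (relabel h H)"
      using c_new(1) by simp
    have "verts (relabel h G) = verts (relabel h H) \<union> (\<lambda>e. h (s (h -` e))) ` (`) h ` T \<union> {h c}"
      by (simp add: verts_G image_Un image_image vimage)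
    moreover have "edges (relabel h G) = (edges (relabel h H) - (`) h ` T) \<union>
      {{u, h (s (h -` e))} | u e. e \<in> (`) h ` T \<and> u \<in> e} \<union> {{h c, h (s (h -` e))} | e. e \<in> (`) h ` T}"
    proof -
      have half: "{{u, s e} | u e. e \<in> T \<and> u \<in> e} = (\<Union>e\<in>T. (\<lambda>u. {u, s e}) ` e)"
        for s :: "'v set \<Rightarrow> 'v" and T
        by blast
      have centre: "{{c, s e} | e. e \<in> T} = (\<lambda>e. {c, s e}) ` T" for c and s :: "'v set \<Rightarrow> 'v" and T
        by blast
      have "(`) h ` (edges H - T) = (`) h ` edges H - (`) h ` T"
        by (rule image_set_diff) (simp add: inj_on_def)
      then show ?thesis
        unfolding half centre by (simp add: edges_relabel edges_G half centre image_Un image_UN image_image vimage)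
    qed
    ultimately show "relabel h G = \<lparr>verts = verts (relabel h H) \<union> (\<lambda>e. h (s (h -` e))) ` (`) h ` T \<union> {h c},
      edges = (edges (relabel h H) - (`) h ` T) \<union> {{u, h (s (h -` e))} | u e. e \<in> (`) h ` T \<and> u \<in> e} \<union>
        {{h c, h (s (h -` e))} | e. e \<in> (`) h ` T}\<rparr>"
      by (intro graph.equality) simp_all
  qed
qed

end

lemma (in relabelling) reduced_triple_relabel:
  "reduced_triple (relabel h G) (h c) = (`) h ` reduced_triple G c"
  by (simp add: reduced_triple_def image_image image_set_diff[OF inj_h])

lemma (in relabelling) reduct_relabel: "reduct (relabel h G) (h c) = relabel h (reduct G c)"
proof -
  let ?N = "insert c (nbrs G c)"
  have N: "insert (h c) (h ` nbrs G c) = h ` ?N"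
    by simp
  have "{e \<in> (`) h ` edges G. e \<inter> h ` ?N = {}} = (`) h ` {e \<in> edges G. e \<inter> ?N = {}}"
    unfolding N by (auto simp del: image_insert simp: image_Int[OF inj_h, symmetric])
  then show ?thesis
    unfolding reduct_def nbrs_relabel N reduced_triple_relabel edges_relabel
    by (simp add: relabel_def image_Un image_set_diff[OF inj_h] del: image_insert)
qed

lemma relabelling_comp: "bij g \<Longrightarrow> bij h \<Longrightarrow> relabelling (g \<circ> h)"
  by (simp add: relabelling_def bij_comp)

section \<open>Existence and uniqueness of accepted centres\<close>

lemma ex_accepted:
  assumes "cubic G" "connected_graph G" "enat 5 \<le> girth G"
  obtains c where "accepted canon G c"
proof -
  have G: "simple_graph G"
    using assms(1) by (simp add: cubic_def)
  obtain a where "reducible_tripod G a"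
    using ex_non_cut_vertex[OF G assms(2)] reducible_tripodI[OF assms(1,3)] by metis
  moreover have "finite {c. reducible_tripod G c}"
    using simple_graphD(1)[OF G] by (rule finite_subset[rotated]) (auto simp: reducible_tripod_def)
  ultimately have "\<exists>c. is_arg_min (tripod_value canon G) (\<lambda>c. c \<in> {c. reducible_tripod G c}) c"
    by (intro ex_is_arg_min_if_finite) auto
  then show thesis
    using that by (auto simp: accepted_def)
qed

lemma accepted_same_orbit:
  assumes "canonical_labelling canon" "simple_graph G" "accepted canon G a" "accepted canon G b"
  obtains f where "graph_iso f G G" "f a = b"
proof -
  have "tripod_value canon G a = tripod_value canon G b"
    using assms(3,4) by (auto simp: accepted_def is_arg_min_linorder intro: order.antisym)
  then have "min_orbit_label canon G a = min_orbit_label canon G b"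
    by (simp add: tripod_value_def)
  moreover have "a \<in> verts G" "b \<in> verts G"
    using assms(3,4) by (auto simp: accepted_def is_arg_min_def reducible_tripod_def)
  ultimately show thesis
    using min_orbit_label_eqD[OF assms(1,2)] that by metis
qed

text \<open>Transported along an isomorphism, c becomes an accepted centre of G', which an
  automorphism of G' moves to c'. The composite, extended to the whole type, carries G to G' and c
  to c'; as H and T are functions of the graph and its centre, it carries them to H' and T'.\<close>

lemma accepted_iso_pair:
  fixes G :: "'v graph" and G' :: "'v graph"
  assumes canon: "canonical_labelling canon"
    and "tripod H T G c s" "tripod H' T' G' c' s'"
    and "accepted canon G c" "accepted canon G' c'" "isomorphic G G'"
  obtains h where "graph_iso h H H'" "(\<lambda>e. h ` e) ` T = T'"
proof -
  interpret A: tripod H T G c s by fact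
  interpret B: tripod H' T' G' c' s' by fact
  obtain f where "graph_iso f G G'"
    using assms(6) by (auto simp: isomorphic_def)
  then obtain f1 where f1: "bij f1" "relabel f1 G = G'"
    using A.simple_G by (rule graph_iso_extend_bij) blast
  interpret f1: relabelling f1
    using f1(1) by unfold_locales
  have "accepted canon G' (f1 c)"
    using f1.accepted_relabel[OF canon A.simple_G assms(4)] f1(2) by simp
  then obtain a where a: "graph_iso a G' G'" "a (f1 c) = c'"
    using accepted_same_orbit[OF canon B.simple_G _ assms(5)] by metis
  obtain f2 where f2: "bij f2" "\<And>x. x \<in> verts G' \<Longrightarrow> f2 x = a x" "relabel f2 G' = G'"
    using a(1) B.simple_G by (rule graph_iso_extend_bij) blast
  define h where "h = f2 \<circ> f1"
  interpret h: relabelling h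
    unfolding h_def using f2(1) f1(1) by (rule relabelling_comp)
  have "relabel h G = G'"
    unfolding h_def relabel_comp[symmetric] f1(2) f2(3) ..
  moreover have "f1 c \<in> verts G'"
    unfolding f1(2)[symmetric] by (simp add: A.verts_G)
  then have "h c = c'"
    using f2(2) a(2) by (simp add: h_def)
  ultimately have "relabel h H = H'" "(`) h ` T = T'"
    using h.reduct_relabel[of G c] h.reduced_triple_relabel[of G c]
    by (simp_all add: A.reduct_G B.reduct_G A.reduced_triple_G B.reduced_triple_G)
  then show thesis
    using that[of h] h.graph_iso_relabel[of H] by simp
qed

text \<open>Extended to a permutation, f turns G into an insertion at T' in H'. This may differ from
  G' in the new vertices, but an isomorphism matches the centres, and acceptance is invariant under
  both maps.\<close>

lemma isomorphic_tripod_accepted: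
  fixes G :: "'v graph" and H' :: "'v graph"
  assumes canon: "canonical_labelling canon"
    and "tripod H T G c s" "accepted canon G c" "graph_iso f H H'" "(\<lambda>e. f ` e) ` T = T'"
    and "tripod H' T' G' c' s'"
  shows "isomorphic G G'" "accepted canon G' c'"
proof -
  interpret A: tripod H T G c s by fact
  obtain h where h: "bij h" "\<And>x. x \<in> verts H \<Longrightarrow> h x = f x" "relabel h H = H'"
    using assms(4) A.simple_H by (rule graph_iso_extend_bij) blast
  interpret h: relabelling h
    using h(1) by unfold_locales
  have "h ` e = f ` e" if "e \<in> T" for e
    using A.T_edges(2)[OF that] h(2) by (auto intro!: image_cong)
  then have "(`) h ` T = T'"
    using assms(5) by (simp cong: image_cong)
  then have "tripod H' T' (relabel h G) (h c) (\<lambda>e. h (s (h -` e)))"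
    using h.tripod_relabel[OF assms(2)] h(3) by simp
  then obtain g where g: "graph_iso g (relabel h G) G'" "g (h c) = c'"
    using assms(6) by (rule tripod_unique)
  show "isomorphic G G'"
    using graph_iso_comp[OF h.graph_iso_relabel g(1)] by (auto simp: isomorphic_def)
  have simple: "simple_graph (relabel h G)"
    using A.simple_G by (rule h.simple_relabel)
  obtain g' where g': "bij g'" "\<And>x. x \<in> verts (relabel h G) \<Longrightarrow> g' x = g x" "relabel g' (relabel h G) = G'"
    using g(1) simple by (rule graph_iso_extend_bij) blast
  interpret g': relabelling g'
    using g'(1) by unfold_locales
  have "g' (h c) = c'"
    using g' g(2) by (simp add: A.verts_G)
  then show "accepted canon G' c'"
    using g'.accepted_relabel[OF canon simple h.accepted_relabel[OF canon A.simple_G assms(3)]] g'(3)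
    by simp
qed

lemma eligible_graph_iso:
  fixes f :: "'v \<Rightarrow> 'v"
  assumes "graph_iso f G H" "simple_graph G" "eligible k G T"
  shows "eligible k H ((\<lambda>e. f ` e) ` T)"
proof -
  obtain h where h: "bij h" "\<And>x. x \<in> verts G \<Longrightarrow> h x = f x" "relabel h G = H"
    using assms(1,2) by (rule graph_iso_extend_bij) blast
  interpret h: relabelling h
    using h(1) by unfold_locales
  have "h ` e = f ` e" if "e \<in> T" for e
    using simple_graphD(2)[OF assms(2), of e] that assms(3) h(2)
    by (auto simp: eligible_def edge_triple_def intro!: image_cong)
  then have "(`) h ` T = (\<lambda>e. f ` e) ` T"
    by (simp cong: image_cong)
  then show ?thesis
    using h.eligible_relabel[OF assms(3)] h(3) by simp
qed

theorem theorem3: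
  fixes k :: nat and n :: int
    and canon :: "('v::infinite) graph \<Rightarrow> 'v \<Rightarrow> nat"
    and given :: "'v graph set"
    and reps :: "'v graph \<Rightarrow> 'v set set set"
    and ins :: "'v graph \<Rightarrow> 'v set set \<Rightarrow> 'v graph"
    and cen :: "'v graph \<Rightarrow> 'v set set \<Rightarrow> 'v"
  assumes "k \<ge> 5"
    and "canonical_labelling canon"
    and "exactly_one_representative (\<lambda>H. H) given
           {H. connected_graph H \<and> cubic H \<and> int (card (verts H)) = n - 4 \<and>
               enat (k - 1) \<le> girth H \<and> at_most_disjoint_cycles H 3 (k - 1)}"
    and "\<And>H T. H \<in> given \<Longrightarrow> T \<in> reps H \<Longrightarrow> eligible k H T"
    and "\<And>H T. H \<in> given \<Longrightarrow> eligible k H T \<Longrightarrow> \<exists>!T'. T' \<in> reps H \<and> same_triple_orbit H T T'"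
    and "\<And>H T. H \<in> given \<Longrightarrow> T \<in> reps H \<Longrightarrow> tripod_insertion H T (ins H T) (cen H T)"
  shows "exactly_one_representative (\<lambda>(H, T). ins H T)
           {(H, T). H \<in> given \<and> T \<in> reps H \<and> accepted canon (ins H T) (cen H T)}
           {G. connected_graph G \<and> cubic G \<and> int (card (verts G)) = n \<and> enat k \<le> girth G}"
proof -
  note k = assms(1) and canon = assms(2)
  let ?\<H> = "{H :: 'v graph. connected_graph H \<and> cubic H \<and> int (card (verts H)) = n - 4 \<and>
    enat (k - 1) \<le> girth H \<and> at_most_disjoint_cycles H 3 (k - 1)}"
  let ?\<G> = "{G :: 'v graph. connected_graph G \<and> cubic G \<and> int (card (verts G)) = n \<and> enat k \<le> girth G}"
  let ?I = "{(H, T). H \<in> given \<and> T \<in> reps H \<and> accepted canon (ins H T) (cen H T)}"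
  have given_class: "\<forall>H\<in>given. H \<in> ?\<H>"
    using assms(3)[unfolded exactly_one_representative_def] by (rule conjunct1)
  have given_rep: "\<forall>H\<in>?\<H>. \<exists>!H'. H' \<in> given \<and> isomorphic H H'"
    using assms(3)[unfolded exactly_one_representative_def] by (rule conjunct2)
  have given: "connected_graph H" "cubic H" "int (card (verts H)) = n - 4" "enat (k - 1) \<le> girth H"
    "simple_graph H" if "H \<in> given" for H
    using bspec[OF given_class that] by (simp_all add: cubic_def)
  have given_unique: "H = H'" if "H \<in> given" "H' \<in> given" "isomorphic H H'" for H H'
  proof -
    \<comment> \<open>H lies in the class being represented, so it has exactly one isomorphic given
      graph; H itself and H' both qualify.\<close>
    have "isomorphic H H"
      unfolding isomorphic_def graph_iso_def
      using relabel_id[OF given(5)[OF that(1)], of id] by (intro exI[of _ id]) simp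
    moreover have "\<exists>!H'. H' \<in> given \<and> isomorphic H H'"
      using bspec[OF given_rep bspec[OF given_class that(1)]] .
    ultimately show ?thesis
      using that by blast
  qed
  have tripod: "\<exists>s. tripod H T (ins H T) (cen H T) s" if "H \<in> given" "T \<in> reps H" for H T
    using assms(6)[OF that] tripod_insertion_iff[OF given(5)[OF that(1)]] by simp
  have sound: "ins H T \<in> ?\<G>" if H: "H \<in> given" "T \<in> reps H" for H T
  proof -
    obtain s where "tripod H T (ins H T) (cen H T) s"
      using tripod[OF H] by blast
    then interpret tripod H T "ins H T" "cen H T" s .
    show ?thesis
      using connected_G cubic_iff card_verts_G girth_G[OF k _ assms(4)[OF H]] given[OF H(1)] by simp
  qed
  have complete: "\<exists>i\<in>?I. isomorphic G ((\<lambda>(H, T). ins H T) i)" if G: "G \<in> ?\<G>" for G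
  proof -
    have girth: "enat 5 \<le> girth G"
      using G k by (auto intro: order.trans[of _ "enat k"])
    obtain c where c: "accepted canon G c"
      using ex_accepted[of G canon] G girth by blast
    then have red: "c \<in> verts G" "\<not> cut_vertex G c"
      by (auto simp: accepted_def is_arg_min_def reducible_tripod_def)
    define H T where "H = reduct G c" and "T = reduced_triple G c"
    obtain s where s: "tripod H T G c s"
      using tripod_reduct[of G c] G girth red(1) unfolding H_def T_def by blast
    then interpret tripod H T G c s .
    have "H \<in> ?\<H>"
      using G connected_H[OF _ red(2)] cubic_iff card_verts_G girth_H[OF k] disjoint_short_cycles_H[OF k]
      by auto
    \<comment> \<open>Only an isomorphic copy H' of the reduction is given, and only one triple per
      orbit is used. The triple is therefore moved twice, by f into H' and by an automorphism a to
      the chosen representative.\<close>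
    from bspec[OF given_rep this] obtain H' f where H': "H' \<in> given" "graph_iso f H H'"
      unfolding isomorphic_def by blast
    have "eligible k H T"
      using eligible_triple[OF k] G by blast
    then have "eligible k H' ((\<lambda>e. f ` e) ` T)"
      using H'(2) simple_H by (intro eligible_graph_iso)
    then obtain T' a where T': "T' \<in> reps H'" "graph_iso a H' H'" "(\<lambda>e. a ` e) ` (\<lambda>e. f ` e) ` T = T'"
      using assms(5)[OF H'(1)] unfolding same_triple_orbit_def by blast
    have af: "graph_iso (a \<circ> f) H H'" "(\<lambda>e. (a \<circ> f) ` e) ` T = T'"
      using graph_iso_comp[OF H'(2) T'(2)] T'(3) by (simp_all add: image_comp comp_def)
    obtain s' where "tripod H' T' (ins H' T') (cen H' T') s'"
      using tripod[OF H'(1) T'(1)] by blast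
    then have "isomorphic G (ins H' T')" "accepted canon (ins H' T') (cen H' T')"
      using isomorphic_tripod_accepted[OF canon s c af] by blast+
    then show ?thesis
      using H'(1) T'(1) by (intro bexI[of _ "(H', T')"]) auto
  qed
  have unique: "H = H' \<and> T = T'"
    if i: "(H, T) \<in> ?I" "(H', T') \<in> ?I" and iso: "isomorphic (ins H T) (ins H' T')" for H T H' T'
  proof -
    have H: "H \<in> given" "T \<in> reps H" "H' \<in> given" "T' \<in> reps H'"
      using i by auto
    obtain s s' where "tripod H T (ins H T) (cen H T) s" "tripod H' T' (ins H' T') (cen H' T') s'"
      using tripod H by meson
    then obtain h where h: "graph_iso h H H'" "(\<lambda>e. h ` e) ` T = T'"
      using accepted_iso_pair[OF canon _ _ _ _ iso] i by blast
    then have "H = H'"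
      using given_unique H unfolding isomorphic_def by blast
    \<comment> \<open>Both T and T' are chosen representatives of the orbit of T, and there is only
      one.\<close>
    moreover have "same_triple_orbit H T T'"
      using h \<open>H = H'\<close> unfolding same_triple_orbit_def by blast
    moreover have "same_triple_orbit H T T"
      unfolding same_triple_orbit_def graph_iso_def
      using relabel_id[OF given(5)[OF H(1)], of id] by (intro exI[of _ id]) simp
    ultimately show ?thesis
      using assms(5)[OF H(1) assms(4)[OF H(1,2)]] H by blast
  qed
  show ?thesis
    unfolding exactly_one_representative_def
  proof (intro conjI ballI)
    fix i assume "i \<in> ?I"
    then obtain H T where "i = (H, T)" "H \<in> given" "T \<in> reps H"
      by blast
    then show "(\<lambda>(H, T). ins H T) i \<in> ?\<G>"
      using sound[of H T] by simp
  next
    fix G assume G: "G \<in> ?\<G>"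
    then obtain i where i: "i \<in> ?I" "isomorphic G ((\<lambda>(H, T). ins H T) i)"
      using complete by blast
    have simple: "simple_graph G"
      using G by (simp add: cubic_def)
    show "\<exists>!i. i \<in> ?I \<and> isomorphic G ((\<lambda>(H, T). ins H T) i)"
    proof (intro ex1I[of _ i] conjI i)
      fix j assume j: "j \<in> ?I \<and> isomorphic G ((\<lambda>(H, T). ins H T) j)"
      obtain H T H' T' where ij: "j = (H, T)" "i = (H', T')"
        by (cases i, cases j)
      have "isomorphic (ins H T) (ins H' T')"
        using isomorphic_trans[OF isomorphic_sym[OF _ simple]] i(2) j ij by auto
      then have "H = H' \<and> T = T'"
        using i(1) j unfolding ij by (intro unique) auto
      then show "j = i"
        unfolding ij by simp
    qed
  qed
qed

end
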